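(* Let $X$ be a Banach space with a basis $(e_i)$. Assume that for some $K<\infty$ every spreading model of any normalized block basis of $(e_i)$ is $K$-equivalent to the unit vector basis of $\ell_1$. Then $X$ is block asymptotically symmetric with respect to $(e_i)$.
   Context: A sequence $(\tilde x_i)$ (in some normed space) is a spreading model of a normalized basic sequence $(x_i)$ if for all $\varepsilon>0$ and $k\in\mathbb{N}$ there exists $n\in\mathbb{N}$ so that for all $n\le n_1<\cdots<n_k$ and all scalars $(a_i)_{i=1}^k$ with each $|a_i|\le 1$, $$\Big|\,\Big\|\sum_{i=1}^k a_ix_{n_i}\Big\|-\Big\|\sum_{i=1}^k a_i\tilde x_i\Big\|\,\Big|<\varepsilon.$$ Two sequences $(x_i)$ and $(y_i)$ are $K$-equivalent if there are $A,B>0$ with $AB\le K$ such that $A^{-1}\|\sum a_iy_i\|\le\|\sum a_ix_i\|\le B\|\sum a_iy_i\|$ for all finitely supported scalar sequences $(a_i)$. $X$ is block asymptotically symmetric with respect to a basis $(e_i)$ if there is $C<\infty$ such that for all $m\in\mathbb{N}$, all bounded block bases $(x_n^i)_{n=1}^\infty$ of $(e_i)$, $1\le i\le m$, and all permutations $\sigma$ of $\{1,\ldots,m\}$, $$\lim_{n_1\to\infty}\cdots\lim_{n_m\to\infty}\Big\|\sum_{i=1}^m x_{n_i}^i\Big\|\le C\lim_{n_{\sigma(1)}\to\infty}\cdots\lim_{n_{\sigma(m)}\to\infty}\Big\|\sum_{i=1}^m x_{n_i}^i\Big\|,$$ provided that these iterated limits exist. *)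

theory Defs
  imports "HOL-Analysis.Analysis" "HOL-Combinatorics.Permutations"
begin

(* Scalars are real throughout, and all sequences are indexed from 0. *)

subsection \<open>Bases and block bases\<close>

definition schauder_basis :: "(nat \<Rightarrow> 'a::banach) \<Rightarrow> bool" where
  "schauder_basis e \<longleftrightarrow> (\<forall>x. \<exists>!a::nat \<Rightarrow> real. (\<lambda>i. a i *\<^sub>R e i) sums x)"

definition block_basis :: "(nat \<Rightarrow> 'a::real_vector) \<Rightarrow> (nat \<Rightarrow> 'a) \<Rightarrow> bool" where
  "block_basis e x \<longleftrightarrow>
     (\<exists>(p :: nat \<Rightarrow> nat) (a :: nat \<Rightarrow> real). strict_mono p \<and>
        (\<forall>n. x n = (\<Sum>i\<in>{p n..<p (Suc n)}. a i *\<^sub>R e i) \<and> x n \<noteq> 0))"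

definition normalized :: "(nat \<Rightarrow> 'a::real_normed_vector) \<Rightarrow> bool" where
  "normalized x \<longleftrightarrow> (\<forall>n. norm (x n) = 1)"


subsection \<open>Spreading models and equivalence of sequences\<close>

(* Meant for normalized basic sequences x; the normalized block bases of a
   Schauder basis, to which it is applied, are always basic. *)
definition spreading_model ::
  "(nat \<Rightarrow> 'a::real_normed_vector) \<Rightarrow> (nat \<Rightarrow> 'b::real_normed_vector) \<Rightarrow> bool" where
  "spreading_model x y \<longleftrightarrow>
     (\<forall>\<epsilon>>0. \<forall>k::nat. \<exists>n::nat. \<forall>(s :: nat \<Rightarrow> nat) (a :: nat \<Rightarrow> real).
        strict_mono_on {..<k} s \<and> (\<forall>i<k. n \<le> s i) \<and> (\<forall>i<k. \<bar>a i\<bar> \<le> 1) \<longrightarrow>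
        \<bar>norm (\<Sum>i<k. a i *\<^sub>R x (s i)) - norm (\<Sum>i<k. a i *\<^sub>R y i)\<bar> < \<epsilon>)"

definition K_equivalent ::
  "real \<Rightarrow> (nat \<Rightarrow> 'a::real_normed_vector) \<Rightarrow> (nat \<Rightarrow> 'b::real_normed_vector) \<Rightarrow> bool" where
  "K_equivalent K x y \<longleftrightarrow>
     (\<exists>A>0. \<exists>B>0. A * B \<le> K \<and>
        (\<forall>a :: nat \<Rightarrow> real. finite {i. a i \<noteq> 0} \<longrightarrow>
           inverse A * norm (\<Sum>i | a i \<noteq> 0. a i *\<^sub>R y i) \<le> norm (\<Sum>i | a i \<noteq> 0. a i *\<^sub>R x i) \<and>
           norm (\<Sum>i | a i \<noteq> 0. a i *\<^sub>R x i) \<le> B * norm (\<Sum>i | a i \<noteq> 0. a i *\<^sub>R y i)))"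


subsection \<open>The space of absolutely summable sequences\<close>

typedef l1 = "{a :: nat \<Rightarrow> real. summable (\<lambda>i. \<bar>a i\<bar>)}"
  morphisms l1_coord Abs_l1
  by (rule exI[of _ "\<lambda>_. 0"]) simp

setup_lifting type_definition_l1

instantiation l1 :: real_normed_vector
begin

lift_definition zero_l1 :: l1 is "\<lambda>_. 0" by simp

lift_definition plus_l1 :: "l1 \<Rightarrow> l1 \<Rightarrow> l1" is "\<lambda>a b i. a i + b i"
proof -
  fix a b :: "nat \<Rightarrow> real"
  assume "summable (\<lambda>i. \<bar>a i\<bar>)" "summable (\<lambda>i. \<bar>b i\<bar>)"
  then have "summable (\<lambda>i. \<bar>a i\<bar> + \<bar>b i\<bar>)" by (rule summable_add)
  then show "summable (\<lambda>i. \<bar>a i + b i\<bar>)"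
    by (rule summable_comparison_test'[where N = 0]) (simp add: abs_triangle_ineq)
qed

lift_definition uminus_l1 :: "l1 \<Rightarrow> l1" is "\<lambda>a i. - a i" by simp

lift_definition minus_l1 :: "l1 \<Rightarrow> l1 \<Rightarrow> l1" is "\<lambda>a b i. a i - b i"
proof -
  fix a b :: "nat \<Rightarrow> real"
  assume "summable (\<lambda>i. \<bar>a i\<bar>)" "summable (\<lambda>i. \<bar>b i\<bar>)"
  then have "summable (\<lambda>i. \<bar>a i\<bar> + \<bar>b i\<bar>)" by (rule summable_add)
  then show "summable (\<lambda>i. \<bar>a i - b i\<bar>)"
    by (rule summable_comparison_test'[where N = 0]) (simp add: abs_triangle_ineq4)
qed

lift_definition scaleR_l1 :: "real \<Rightarrow> l1 \<Rightarrow> l1" is "\<lambda>c a i. c * a i"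
  by (simp add: abs_mult summable_mult)

lift_definition norm_l1 :: "l1 \<Rightarrow> real" is "\<lambda>a. \<Sum>i. \<bar>a i\<bar>" .

definition dist_l1 :: "l1 \<Rightarrow> l1 \<Rightarrow> real" where
  "dist_l1 a b = norm (a - b)"

definition sgn_l1 :: "l1 \<Rightarrow> l1" where
  "sgn_l1 a = inverse (norm a) *\<^sub>R a"

definition uniformity_l1 :: "(l1 \<times> l1) filter" where
  "uniformity_l1 = (INF e\<in>{0<..}. principal {(x, y). dist x y < e})"

definition open_l1 :: "l1 set \<Rightarrow> bool" where
  "open_l1 U \<longleftrightarrow> (\<forall>x\<in>U. eventually (\<lambda>(x', y). x' = x \<longrightarrow> y \<in> U) uniformity)"

instance
proof
  fix x y z :: l1 and c d :: real
  show "x + y + z = x + (y + z)" by transfer (simp add: add.assoc)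
  show "x + y = y + x" by transfer (simp add: add.commute)
  show "0 + x = x" by transfer simp
  show "- x + x = 0" by transfer simp
  show "x - y = x + - y" by transfer simp
  show "c *\<^sub>R (x + y) = c *\<^sub>R x + c *\<^sub>R y" by transfer (simp add: distrib_left)
  show "(c + d) *\<^sub>R x = c *\<^sub>R x + d *\<^sub>R x" by transfer (simp add: distrib_right)
  show "c *\<^sub>R d *\<^sub>R x = (c * d) *\<^sub>R x" by transfer (simp add: mult.assoc)
  show "1 *\<^sub>R x = x" by transfer simp
  show "dist x y = norm (x - y)" by (rule dist_l1_def)
  show "sgn x = inverse (norm x) *\<^sub>R x" by (rule sgn_l1_def)
  show "uniformity = (INF e\<in>{0<..}. principal {(x, y :: l1). dist x y < e})"
    by (rule uniformity_l1_def)
  show "open U \<longleftrightarrow> (\<forall>x\<in>U. eventually (\<lambda>(x', y). x' = x \<longrightarrow> y \<in> U) uniformity)" for U :: "l1 set"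
    by (rule open_l1_def)
  show "norm x = 0 \<longleftrightarrow> x = 0"
    by transfer (auto simp: suminf_eq_zero_iff fun_eq_iff)
  show "norm (x + y) \<le> norm x + norm y"
  proof transfer
    fix a b :: "nat \<Rightarrow> real"
    assume s: "summable (\<lambda>i. \<bar>a i\<bar>)" "summable (\<lambda>i. \<bar>b i\<bar>)"
    have s2: "summable (\<lambda>i. \<bar>a i\<bar> + \<bar>b i\<bar>)" using s by (rule summable_add)
    then have s3: "summable (\<lambda>i. \<bar>a i + b i\<bar>)"
      by (rule summable_comparison_test'[where N = 0]) (simp add: abs_triangle_ineq)
    have "(\<Sum>i. \<bar>a i + b i\<bar>) \<le> (\<Sum>i. \<bar>a i\<bar> + \<bar>b i\<bar>)"
      by (rule suminf_le[OF _ s3 s2]) (rule abs_triangle_ineq)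
    then show "(\<Sum>i. \<bar>a i + b i\<bar>) \<le> (\<Sum>i. \<bar>a i\<bar>) + (\<Sum>i. \<bar>b i\<bar>)"
      by (simp add: suminf_add[OF s])
  qed
  show "norm (c *\<^sub>R x) = \<bar>c\<bar> * norm x"
    by transfer (simp add: abs_mult suminf_mult)
qed

end

lift_definition l1_unit :: "nat \<Rightarrow> l1" is "\<lambda>n i. if i = n then 1 else 0"
proof -
  fix n :: nat
  show "summable (\<lambda>i. \<bar>if i = n then 1 else (0::real)\<bar>)"
    by (rule summable_finite[of "{n}"]) auto
qed

lemma l1_coord_sum_unit:
  assumes "finite I"
  shows "l1_coord (\<Sum>i\<in>I. a i *\<^sub>R l1_unit i) j = (if j \<in> I then a j else 0)"
  using assms
  by (induction I) (auto simp: zero_l1.rep_eq plus_l1.rep_eq scaleR_l1.rep_eq l1_unit.rep_eq)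

lemma norm_sum_l1_unit:
  assumes "finite I"
  shows "norm (\<Sum>i\<in>I. a i *\<^sub>R l1_unit i) = (\<Sum>i\<in>I. \<bar>a i\<bar>)"
  using assms by (simp add: norm_l1.rep_eq l1_coord_sum_unit suminf_finite[of I])


subsection \<open>A universal host for spreading models\<close>

(* A statement cannot quantify over all normed spaces in a hypothesis, since these range
   over types.  It suffices to consider sequences in l_infinity, which contains every
   sequence of every normed space isometrically; lemma spreading_models_in_linf_suffice
   below makes this precise.  The topology on nat is discrete, so the type below consists
   of all bounded real sequences with the supremum norm. *)
type_synonym linf = "nat \<Rightarrow>\<^sub>C real"

lemma norming_functional_step:
  fixes w :: "nat \<Rightarrow> 'b::real_normed_vector" and c :: "nat \<Rightarrow> real"
  assumes c: "\<And>a. (\<Sum>i<n. a i * c i) \<le> norm (\<Sum>i<n. a i *\<^sub>R w i)"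
  shows "\<exists>t. \<forall>a. (\<Sum>i<n. a i * c i) + a n * t \<le> norm ((\<Sum>i<n. a i *\<^sub>R w i) + a n *\<^sub>R w n)"
proof -
  define L where "L a = (\<Sum>i<n. a i * c i) - norm ((\<Sum>i<n. a i *\<^sub>R w i) - w n)" for a
  define U where "U a = norm ((\<Sum>i<n. a i *\<^sub>R w i) + w n) - (\<Sum>i<n. a i * c i)" for a
  have LU: "L a \<le> U b" for a b
  proof -
    have "(\<Sum>i<n. a i * c i) + (\<Sum>i<n. b i * c i) = (\<Sum>i<n. (a i + b i) * c i)"
      by (simp add: distrib_right sum.distrib)
    also have "\<dots> \<le> norm (\<Sum>i<n. (a i + b i) *\<^sub>R w i)" by (rule c)
    also have "(\<Sum>i<n. (a i + b i) *\<^sub>R w i) =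
        ((\<Sum>i<n. a i *\<^sub>R w i) - w n) + ((\<Sum>i<n. b i *\<^sub>R w i) + w n)"
      by (simp add: scaleR_left_distrib sum.distrib)
    also have "norm \<dots> \<le> norm ((\<Sum>i<n. a i *\<^sub>R w i) - w n) + norm ((\<Sum>i<n. b i *\<^sub>R w i) + w n)"
      by (rule norm_triangle_ineq)
    finally show ?thesis by (simp add: L_def U_def)
  qed
  define t where "t = (SUP a. L a)"
  have bdd: "bdd_above (range L)" using LU by (auto simp: bdd_above_def)
  have Lt: "L a \<le> t" for a unfolding t_def by (rule cSUP_upper[OF _ bdd]) simp
  have tU: "t \<le> U b" for b unfolding t_def by (rule cSUP_least) (use LU in auto)
  have "(\<Sum>i<n. a i * c i) + a n * t \<le> norm ((\<Sum>i<n. a i *\<^sub>R w i) + a n *\<^sub>R w n)" for a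
  proof -
    let ?d = "a n"
    consider "?d = 0" | "?d > 0" | "?d < 0" by linarith
    then show ?thesis
    proof cases
      case 1
      then show ?thesis using c[of a] by simp
    next
      case 2
      let ?b = "\<lambda>i. a i / ?d"
      have sc: "?d * (\<Sum>i<n. ?b i * c i) = (\<Sum>i<n. a i * c i)"
        unfolding sum_distrib_left by (rule sum.cong) (use 2 in auto)
      have sv: "?d *\<^sub>R ((\<Sum>i<n. ?b i *\<^sub>R w i) + w n) = (\<Sum>i<n. a i *\<^sub>R w i) + ?d *\<^sub>R w n"
        unfolding scaleR_add_right scaleR_sum_right by (rule arg_cong2[where f = plus])
          (use 2 in \<open>auto intro!: sum.cong\<close>)
      have "?d * t \<le> ?d * U ?b" by (rule mult_left_mono[OF tU]) (use 2 in simp)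
      also have "\<dots> = norm (?d *\<^sub>R ((\<Sum>i<n. ?b i *\<^sub>R w i) + w n)) - ?d * (\<Sum>i<n. ?b i * c i)"
        unfolding U_def norm_scaleR using 2 by (simp add: right_diff_distrib)
      finally show ?thesis unfolding sc sv by simp
    next
      case 3
      let ?b = "\<lambda>i. a i / (- ?d)"
      have sc: "(- ?d) * (\<Sum>i<n. ?b i * c i) = (\<Sum>i<n. a i * c i)"
        unfolding sum_distrib_left by (rule sum.cong) (use 3 in auto)
      have sv: "(- ?d) *\<^sub>R ((\<Sum>i<n. ?b i *\<^sub>R w i) - w n) = (\<Sum>i<n. a i *\<^sub>R w i) + ?d *\<^sub>R w n"
      proof -
        have "(- ?d) *\<^sub>R (\<Sum>i<n. ?b i *\<^sub>R w i) = (\<Sum>i<n. a i *\<^sub>R w i)"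
          unfolding scaleR_sum_right by (rule sum.cong) (use 3 in auto)
        then show ?thesis by (simp add: scaleR_diff_right)
      qed
      have "(- ?d) * L ?b \<le> (- ?d) * t" by (rule mult_left_mono[OF Lt]) (use 3 in simp)
      moreover have "(- ?d) * L ?b =
          (- ?d) * (\<Sum>i<n. ?b i * c i) - norm ((- ?d) *\<^sub>R ((\<Sum>i<n. ?b i *\<^sub>R w i) - w n))"
        unfolding L_def norm_scaleR using 3 by (simp add: right_diff_distrib)
      ultimately show ?thesis unfolding sc sv by simp
    qed
  qed
  then show ?thesis by blast
qed

lemma norming_functional:
  fixes w :: "nat \<Rightarrow> 'b::real_normed_vector"
  shows "\<exists>c. c 0 = norm (w 0) \<and> (\<forall>n a. \<bar>\<Sum>i<n. a i * c i\<bar> \<le> norm (\<Sum>i<n. a i *\<^sub>R w i))"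
proof -
  define P where "P n c \<longleftrightarrow> c 0 = norm (w 0) \<and>
      (\<forall>a. (\<Sum>i<Suc n. a i * c i) \<le> norm (\<Sum>i<Suc n. a i *\<^sub>R w i))" for n and c :: "nat \<Rightarrow> real"
  define Q where "Q n c c' \<longleftrightarrow> (\<forall>i\<le>n. c' i = c i)" for n :: nat and c c' :: "nat \<Rightarrow> real"
  have "\<exists>f. \<forall>n. P n (f n) \<and> Q n (f n) (f (Suc n))"
  proof (rule dependent_nat_choice)
    show "\<exists>c. P 0 c"
      by (rule exI[of _ "\<lambda>_. norm (w 0)"]) (auto simp: P_def intro: mult_right_mono)
  next
    fix c n assume Pc: "P n c"
    obtain t where t: "\<And>a. (\<Sum>i<Suc n. a i * c i) + a (Suc n) * t
        \<le> norm ((\<Sum>i<Suc n. a i *\<^sub>R w i) + a (Suc n) *\<^sub>R w (Suc n))"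
      using norming_functional_step[where n = "Suc n" and c = c and w = w] Pc unfolding P_def by blast
    have "P (Suc n) (c(Suc n := t))"
      unfolding P_def
    proof (intro conjI allI)
      show "(c(Suc n := t)) 0 = norm (w 0)" using Pc by (simp add: P_def)
      fix a
      have "(\<Sum>i<Suc n. a i * (c(Suc n := t)) i) = (\<Sum>i<Suc n. a i * c i)"
        by (rule sum.cong) auto
      then show "(\<Sum>i<Suc (Suc n). a i * (c(Suc n := t)) i)
          \<le> norm (\<Sum>i<Suc (Suc n). a i *\<^sub>R w i)"
        using t[of a] by (simp only: sum.lessThan_Suc[of _ "Suc n"] fun_upd_same)
    qed
    moreover have "Q n c (c(Suc n := t))" by (auto simp: Q_def)
    ultimately show "\<exists>c'. P (Suc n) c' \<and> Q n c c'" by blast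
  qed
  then obtain f where fP: "\<And>n. P n (f n)" and fQ: "\<And>n. Q n (f n) (f (Suc n))" by blast
  define c where "c i = f i i" for i
  have stable: "f (i + d) i = f i i" for i d
    by (induction d) (use fQ in \<open>auto simp: Q_def\<close>)
  have cf: "c i = f n i" if "i \<le> n" for i n
    using stable[of i "n - i"] that by (simp add: c_def)
  have le: "(\<Sum>i<n. a i * c i) \<le> norm (\<Sum>i<n. a i *\<^sub>R w i)" for n a
  proof (cases n)
    case (Suc m)
    have "(\<Sum>i<Suc m. a i * c i) = (\<Sum>i<Suc m. a i * f m i)"
      by (rule sum.cong) (auto simp: cf)
    then show ?thesis using fP[of m] Suc by (simp only: P_def)
  qed simp
  have "\<bar>\<Sum>i<n. a i * c i\<bar> \<le> norm (\<Sum>i<n. a i *\<^sub>R w i)" for n a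
    using le[where n = n and a = a] le[where n = n and a = "\<lambda>i. - a i"]
    by (simp add: sum_negf abs_le_iff)
  moreover have "c 0 = norm (w 0)" using fP[of 0] by (simp add: c_def P_def)
  ultimately show ?thesis by blast
qed

lemma isometric_copy_in_linf:
  fixes y :: "nat \<Rightarrow> 'b::real_normed_vector"
  shows "\<exists>z :: nat \<Rightarrow> linf. \<forall>I a. finite I \<longrightarrow>
           norm (\<Sum>i\<in>I. a i *\<^sub>R z i) = norm (\<Sum>i\<in>I. a i *\<^sub>R y i)"
proof -
  define q :: "nat \<Rightarrow> nat \<Rightarrow> real" where
    "q k i = (let xs = (from_nat k :: rat list) in if i < length xs then of_rat (xs ! i) else 0)"
    for k i
  define len where "len k = length (from_nat k :: rat list)" for k
  define d where "d k = (\<Sum>i<len k. q k i *\<^sub>R y i)" for k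
  define w where "w k = case_nat (d k) y" for k
  have "\<exists>c. \<forall>k. c k 0 = norm (d k) \<and>
      (\<forall>n a. \<bar>\<Sum>i<n. a i * c k i\<bar> \<le> norm (\<Sum>i<n. a i *\<^sub>R w k i))"
    using norming_functional[of "w k" for k] by (intro choice) (simp add: w_def)
  then obtain c where c0: "\<And>k. c k 0 = norm (d k)" and
    c: "\<And>k n a. \<bar>\<Sum>i<n. a i * c k i\<bar> \<le> norm (\<Sum>i<n. a i *\<^sub>R w k i)" by blast
  define g where "g k i = c k (Suc i)" for k i
  have g0: "\<bar>b * norm (d k) + (\<Sum>i<n. a i * g k i)\<bar> \<le> norm (b *\<^sub>R d k + (\<Sum>i<n. a i *\<^sub>R y i))"
    for k b n a
    using c[where n = "Suc n" and a = "case_nat b a" and k = k]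
    by (simp add: sum.lessThan_Suc_shift c0 g_def w_def del: sum.lessThan_Suc)
  have g: "\<bar>\<Sum>i<n. a i * g k i\<bar> \<le> norm (\<Sum>i<n. a i *\<^sub>R y i)" for k n a
    using g0[where b = 0 and k = k and n = n and a = a] by simp
  have gd: "(\<Sum>i<len k. q k i * g k i) = norm (d k)" for k
    using g0[where b = "-1" and k = k and n = "len k" and a = "q k"] by (simp add: d_def)
  have gy: "\<bar>g k i\<bar> \<le> norm (y i)" for k i
  proof -
    have "(\<Sum>j<Suc i. (if j = i then 1 else 0) * g k j) = g k i"
      "(\<Sum>j<Suc i. (if j = i then 1 else 0) *\<^sub>R y j) = y i"
      by (simp_all add: if_distrib if_distribR cong: if_cong)
    then show ?thesis using g[where a = "\<lambda>j. if j = i then 1 else 0" and k = k and n = "Suc i"] by simp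
  qed
  define z :: "nat \<Rightarrow> linf" where "z i = Bcontfun (\<lambda>k. g k i)" for i
  have z: "apply_bcontfun (z i) k = g k i" for i k
  proof -
    have "(\<lambda>k. g k i) \<in> bcontfun"
      using gy by (auto simp: bcontfun_def bounded_iff)
    then show ?thesis by (simp add: z_def Bcontfun_inverse)
  qed
  have zsum: "apply_bcontfun (\<Sum>i\<in>I. a i *\<^sub>R z i) k = (\<Sum>i\<in>I. a i * g k i)"
    if "finite I" for I a k
    using that by (induction I) (auto simp: z)
  have main: "norm (\<Sum>i<n. a i *\<^sub>R z i) = norm (\<Sum>i<n. a i *\<^sub>R y i)" for n a
  proof (rule antisym)
    show "norm (\<Sum>i<n. a i *\<^sub>R z i) \<le> norm (\<Sum>i<n. a i *\<^sub>R y i)"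
      by (rule norm_bound) (simp add: zsum g)
    show "norm (\<Sum>i<n. a i *\<^sub>R y i) \<le> norm (\<Sum>i<n. a i *\<^sub>R z i)"
    proof (rule field_le_epsilon)
      fix e :: real assume e: "e > 0"
      define S where "S = (\<Sum>i<n. norm (y i)) + 1"
      have S: "S > 0" unfolding S_def by (intro add_nonneg_pos sum_nonneg) auto
      have "\<exists>r. \<bar>a i - of_rat r\<bar> < e / (2 * S)" for i
      proof -
        have "a i < a i + e / (2 * S)" using e S by simp
        from of_rat_dense[OF this] obtain r where "a i < of_rat r" "of_rat r < a i + e / (2 * S)"
          by blast
        then show ?thesis by (intro exI[of _ r]) linarith
      qed
      then obtain r where r: "\<And>i. \<bar>a i - of_rat (r i)\<bar> < e / (2 * S)" by metis
      define k where "k = to_nat (map r [0..<n])"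
      have len: "len k = n" by (simp add: len_def k_def)
      have qr: "q k i = of_rat (r i)" if "i < n" for i using that by (simp add: q_def k_def)
      have aq: "\<bar>a i - q k i\<bar> \<le> e / (2 * S)" if "i < n" for i
        using r[of i] qr[OF that] by simp
      have sm: "(\<Sum>i<n. \<bar>a i - q k i\<bar> * norm (y i)) \<le> e / 2"
      proof -
        have "(\<Sum>i<n. \<bar>a i - q k i\<bar> * norm (y i)) \<le> (\<Sum>i<n. e / (2 * S) * norm (y i))"
          by (intro sum_mono mult_right_mono aq) auto
        also have "\<dots> = e / (2 * S) * (S - 1)" by (simp add: S_def sum_distrib_left)
        also have "\<dots> \<le> e / (2 * S) * S" by (rule mult_left_mono) (use e S in auto)
        also have "\<dots> = e / 2" using S by simp
        finally show ?thesis .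
      qed
      have "norm (\<Sum>i<n. a i *\<^sub>R y i) \<le> norm (d k) + norm ((\<Sum>i<n. a i *\<^sub>R y i) - d k)"
        by (metis add.commute diff_add_cancel norm_triangle_ineq)
      also have "(\<Sum>i<n. a i *\<^sub>R y i) - d k = (\<Sum>i<n. (a i - q k i) *\<^sub>R y i)"
        by (simp add: d_def len scaleR_left_diff_distrib sum_subtractf)
      also have "norm \<dots> \<le> (\<Sum>i<n. \<bar>a i - q k i\<bar> * norm (y i))"
        by (rule sum_norm_le) simp
      also have "norm (d k) = (\<Sum>i<n. a i * g k i) - (\<Sum>i<n. (a i - q k i) * g k i)"
        using gd[of k] by (simp add: len left_diff_distrib sum_subtractf)
      also have "- (\<Sum>i<n. (a i - q k i) * g k i) \<le> (\<Sum>i<n. \<bar>a i - q k i\<bar> * norm (y i))"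
      proof -
        have "\<bar>\<Sum>i<n. (a i - q k i) * g k i\<bar> \<le> (\<Sum>i<n. \<bar>(a i - q k i) * g k i\<bar>)"
          by (rule sum_abs)
        also have "\<dots> \<le> (\<Sum>i<n. \<bar>a i - q k i\<bar> * norm (y i))"
          by (rule sum_mono) (auto simp: abs_mult intro: mult_left_mono gy)
        finally show ?thesis by linarith
      qed
      then have "(\<Sum>i<n. a i * g k i) - (\<Sum>i<n. (a i - q k i) * g k i)
          \<le> (\<Sum>i<n. a i * g k i) + (\<Sum>i<n. \<bar>a i - q k i\<bar> * norm (y i))" by simp
      finally have "norm (\<Sum>i<n. a i *\<^sub>R y i)
          \<le> (\<Sum>i<n. a i * g k i) + 2 * (\<Sum>i<n. \<bar>a i - q k i\<bar> * norm (y i))" by simp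
      also have "(\<Sum>i<n. a i * g k i) \<le> norm (\<Sum>i<n. a i *\<^sub>R z i)"
        using norm_bounded[of "\<Sum>i<n. a i *\<^sub>R z i" k] by (simp add: zsum)
      finally show "norm (\<Sum>i<n. a i *\<^sub>R y i) \<le> norm (\<Sum>i<n. a i *\<^sub>R z i) + e"
        using sm by simp
    qed
  qed
  show ?thesis
  proof (intro exI allI impI)
    fix I :: "nat set" and a :: "nat \<Rightarrow> real"
    assume "finite I"
    then obtain n where n: "I \<subseteq> {..<n}" by (auto simp: finite_nat_iff_bounded)
    let ?a = "\<lambda>i. if i \<in> I then a i else 0"
    have "(\<Sum>i<n. ?a i *\<^sub>R z i) = (\<Sum>i\<in>I. a i *\<^sub>R z i)"
      by (rule sum.mono_neutral_cong_right) (use n in auto)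
    moreover have "(\<Sum>i<n. ?a i *\<^sub>R y i) = (\<Sum>i\<in>I. a i *\<^sub>R y i)"
      by (rule sum.mono_neutral_cong_right) (use n in auto)
    ultimately show "norm (\<Sum>i\<in>I. a i *\<^sub>R z i) = norm (\<Sum>i\<in>I. a i *\<^sub>R y i)"
      using main[where a = ?a and n = n] by simp
  qed
qed

lemma spreading_models_in_linf_suffice:
  fixes x :: "nat \<Rightarrow> 'a::real_normed_vector" and y :: "nat \<Rightarrow> 'b::real_normed_vector"
    and u :: "nat \<Rightarrow> 'c::real_normed_vector"
  assumes "\<forall>z :: nat \<Rightarrow> linf. spreading_model x z \<longrightarrow> K_equivalent K z u"
    and y: "spreading_model x y"
  shows "K_equivalent K y u"
proof -
  obtain z :: "nat \<Rightarrow> linf"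
    where z: "\<And>I a. finite I \<Longrightarrow> norm (\<Sum>i\<in>I. a i *\<^sub>R z i) = norm (\<Sum>i\<in>I. a i *\<^sub>R y i)"
    using isometric_copy_in_linf[of y] by blast
  have "spreading_model x z" using y unfolding spreading_model_def by (simp add: z)
  then have "K_equivalent K z u" using assms(1) by blast
  then show ?thesis unfolding K_equivalent_def by (simp add: z cong: conj_cong imp_cong)
qed


subsection \<open>Iterated limits and block asymptotic symmetry\<close>

(* For pairwise distinct i1, ..., im, has_iterated_limit [i1, ..., im] f L says that the
   iterated limit of f n as n(i1) tends to infinity (outermost), ..., n(im) tends to
   infinity (innermost) exists and equals L, where f depends only on n(i1), ..., n(im). *)
fun has_iterated_limit :: "nat list \<Rightarrow> ((nat \<Rightarrow> nat) \<Rightarrow> real) \<Rightarrow> real \<Rightarrow> bool" where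
  "has_iterated_limit [] f L \<longleftrightarrow> (\<forall>n. f n = L)"
| "has_iterated_limit (i # is) f L \<longleftrightarrow>
     (\<exists>g :: nat \<Rightarrow> real. (\<forall>k. has_iterated_limit is (\<lambda>n. f (n(i := k))) (g k)) \<and> g \<longlonglongrightarrow> L)"

definition block_asymptotically_symmetric :: "(nat \<Rightarrow> 'a::banach) \<Rightarrow> bool" where
  "block_asymptotically_symmetric e \<longleftrightarrow>
     (\<exists>C::real. \<forall>(m::nat) (x :: nat \<Rightarrow> nat \<Rightarrow> 'a) (\<sigma> :: nat \<Rightarrow> nat) (L::real) (R::real).
        (\<forall>i\<in>{1..m}. block_basis e (x i) \<and> bounded (range (x i))) \<longrightarrow>
        \<sigma> permutes {1..m} \<longrightarrow>
        has_iterated_limit [1..<Suc m] (\<lambda>n. norm (\<Sum>i\<in>{1..m}. x i (n i))) L \<longrightarrow>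
        has_iterated_limit (map \<sigma> [1..<Suc m]) (\<lambda>n. norm (\<Sum>i\<in>{1..m}. x i (n i))) R \<longrightarrow>
        L \<le> C * R)"

end

theory Submission
  imports Defs "HOL-Library.Ramsey" "HOL-Library.Diagonal_Subsequence"
begin

text \<open>
  The constant of block asymptotic symmetry is \<open>K\<close> itself, and the reason is a regrouping.
  Let \<open>W\<^sub>0, W\<^sub>1, \<dots>\<close> be vectors supported on successive blocks, each of the form
  \<open>W\<^sub>j = \<Sum>\<^sub>i X i j\<close> with one term \<open>X i j\<close> from each of the \<open>m\<close> given block bases, chosen so that
  \<open>norm W\<^sub>j\<close> is close to the iterated limit \<open>L\<close> in the natural order. After normalisation the
  \<open>W\<^sub>j\<close> form a block basis, a subsequence has a spreading model, and its \<open>\<ell>\<^sub>1\<close> estimate gives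
  \<open>norm (W\<^sub>t + \<dots> + W\<^bsub>t+N-1\<^esub>) \<ge> N L / K\<close>, up to errors that vanish as \<open>t\<close> grows.

  The same sum can be read along diagonals: the term with index \<open>\<sigma> i\<close> is taken from \<open>W\<^bsub>j+i\<^esub>\<close>. Along
  a diagonal the terms appear in the order \<open>\<sigma> 1, \<dots>, \<sigma> m\<close>, so its norm is close to the permuted
  iterated limit \<open>R\<close> (lemma \<open>ex_fast_block_subsequences\<close> arranges this simultaneously with the
  estimate for \<open>L\<close>). The \<open>N\<close> diagonals miss the whole sum only by boundary terms, whose number
  depends on \<open>m\<close> and not on \<open>N\<close> (lemma \<open>norm_sum_le_diagonals\<close>). Hence
  \<open>N L / K \<le> N R + O(1)\<close>, and \<open>N \<longrightarrow> \<infinity>\<close> gives \<open>L \<le> K R\<close>.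

  The argument rests on the Brunel--Sucheston theorem, that every normalized sequence has a
  subsequence with a spreading model (\<open>ex_spreading_model_subsequence\<close>). Ramsey's theorem and a
  diagonal argument stabilise the norms of linear combinations; the limiting norm then has to be
  realised by a sequence in \<open>\<ell>\<^sub>\<infinity>\<close>, whose coordinates are limits of norming functionals.
\<close>

section \<open>Iterated limits along fast growing indices\<close>

lemma has_iterated_limit_nonneg:
  assumes "has_iterated_limit is f L" and "\<And>n. 0 \<le> f n"
  shows "0 \<le> L"
  using assms
proof (induction "is" arbitrary: f L)
  case Nil
  then show ?case by (metis has_iterated_limit.simps(1))
next
  case (Cons i "is")
  then obtain g where g: "\<And>k. has_iterated_limit is (\<lambda>n. f (n(i := k))) (g k)" "g \<longlonglongrightarrow> L"
    by auto
  have "0 \<le> g k" for k using Cons.IH[OF g(1)] Cons.prems(2) by blast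
  then show ?case using LIMSEQ_le_const[OF g(2)] by blast
qed

text \<open>In an iterated limit the threshold for an index depends on all the indices chosen before it.
  Since only finitely many values lie below a given bound, a single function \<open>\<theta>\<close>, applied to each
  earlier value, majorises all these thresholds. The accuracy enters in the same way: \<open>M\<close> acts as
  one more value chosen before all the others, which makes \<open>\<theta>\<close> independent of the accuracy.\<close>

lemma iterated_limit_along_fast_indices:
  assumes "has_iterated_limit is f L"
  shows "\<exists>\<theta> :: nat \<Rightarrow> nat. \<forall>M n. sorted_wrt (\<lambda>a b. \<theta> a \<le> b) (M # map n is) \<longrightarrow>
           \<bar>f n - L\<bar> \<le> 1 / (real M + 1)"
  using assms
proof (induction "is" arbitrary: f L)
  case Nil
  then show ?case by auto
next
  case (Cons i "is")
  then obtain g where g: "\<And>k. has_iterated_limit is (\<lambda>n. f (n(i := k))) (g k)" "g \<longlonglongrightarrow> L"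
    by auto
  have "\<forall>k. \<exists>\<theta> :: nat \<Rightarrow> nat. \<forall>M n. sorted_wrt (\<lambda>a b. \<theta> a \<le> b) (M # map n is) \<longrightarrow>
      \<bar>f (n(i := k)) - g k\<bar> \<le> 1 / (real M + 1)"
    using Cons.IH[OF g(1)] by blast
  then obtain \<theta> :: "nat \<Rightarrow> nat \<Rightarrow> nat" where
    \<theta>: "\<And>k M n. sorted_wrt (\<lambda>a b. \<theta> k a \<le> b) (M # map n is) \<Longrightarrow>
      \<bar>f (n(i := k)) - g k\<bar> \<le> 1 / (real M + 1)"
    by metis
  have "\<forall>M. \<exists>T. \<forall>k\<ge>T. \<bar>g k - L\<bar> < 1 / (2 * (real M + 1))"
    using LIMSEQ_D[OF g(2)] by (simp add: add_pos_nonneg)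
  then obtain T where T: "\<And>M k. T M \<le> k \<Longrightarrow> \<bar>g k - L\<bar> < 1 / (2 * (real M + 1))" by metis
  \<comment> \<open>The sum majorises the thresholds of the inner limits for every outer value up to \<open>a\<close>,
    \<open>T a\<close> brings \<open>g\<close> close to \<open>L\<close>, and \<open>2 * a + 1\<close> makes the inner error \<open>1 / (k + 1)\<close> at most half of
    \<open>1 / (a + 1)\<close>. As \<open>\<Theta> a \<ge> a\<close>, all values after \<open>k\<close> are at least \<open>k\<close>, so the sum applies to them.\<close>
  define \<Theta> where "\<Theta> a = (\<Sum>k\<le>a. \<theta> k a) + T a + 2 * a + 1" for a
  have le\<Theta>: "\<theta> k a \<le> \<Theta> a" if "k \<le> a" for k a
  proof -
    have "\<theta> k a \<le> (\<Sum>k\<le>a. \<theta> k a)" by (rule member_le_sum) (use that in auto)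
    then show ?thesis by (simp add: \<Theta>_def)
  qed
  show ?case
  proof (intro exI[of _ \<Theta>] allI impI)
    fix M n
    assume sorted: "sorted_wrt (\<lambda>a b. \<Theta> a \<le> b) (M # map n (i # is))"
    define k where "k = n i"
    have \<Theta>k: "\<Theta> M \<le> k" and tail: "sorted_wrt (\<lambda>a b. \<Theta> a \<le> b) (k # map n is)"
      using sorted by (auto simp: k_def)
    have ge: "k \<le> b" if "b \<in> set (k # map n is)" for b
      using tail that by (auto simp: \<Theta>_def)
    have "sorted_wrt (\<lambda>a b. \<theta> k a \<le> b) (k # map n is)"
      by (rule sorted_wrt_mono_rel[OF _ tail]) (use ge le\<Theta> order_trans in blast)
    from \<theta>[OF this] have "\<bar>f n - g k\<bar> \<le> 1 / (real k + 1)" by (simp add: k_def)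
    also have "\<dots> \<le> 1 / (2 * (real M + 1))"
      by (rule divide_left_mono) (use \<Theta>k in \<open>auto simp: \<Theta>_def add_pos_nonneg\<close>)
    finally have "\<bar>f n - g k\<bar> \<le> 1 / (2 * (real M + 1))" .
    moreover have "\<bar>g k - L\<bar> < 1 / (2 * (real M + 1))"
      by (rule T) (use \<Theta>k in \<open>simp add: \<Theta>_def\<close>)
    ultimately have "\<bar>f n - L\<bar> \<le> 2 * (1 / (2 * (real M + 1)))" by linarith
    also have "\<dots> = 1 / (real M + 1)" by (simp add: field_simps)
    finally show "\<bar>f n - L\<bar> \<le> 1 / (real M + 1)" .
  qed
qed

lemma fast_growing_sequence:
  fixes \<theta> :: "nat \<Rightarrow> nat"
  obtains \<kappa> :: "nat \<Rightarrow> nat" where "strict_mono \<kappa>" and "\<And>r s. r < s \<Longrightarrow> \<theta> (\<kappa> r) \<le> \<kappa> s"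
proof -
  define \<kappa> where "\<kappa> = rec_nat 0 (\<lambda>_ v. Suc v + (\<Sum>y\<le>v. \<theta> y))"
  have Suc: "\<kappa> (Suc r) = Suc (\<kappa> r) + (\<Sum>y\<le>\<kappa> r. \<theta> y)" for r by (simp add: \<kappa>_def)
  have mono: "strict_mono \<kappa>" by (simp add: strict_mono_Suc_iff Suc)
  have "\<theta> (\<kappa> r) \<le> \<kappa> s" if "r < s" for r s
  proof -
    have "\<theta> (\<kappa> r) \<le> (\<Sum>y\<le>\<kappa> r. \<theta> y)" by (rule member_le_sum) auto
    also have "\<dots> \<le> \<kappa> (Suc r)" by (simp add: Suc)
    also have "\<dots> \<le> \<kappa> s" using that strict_mono_less_eq[OF mono] by simp
    finally show ?thesis .
  qed
  with mono show ?thesis by (rule that)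
qed

section \<open>Block bases\<close>

lemma in_span_imageD:
  assumes "finite I" and "v \<in> span (e ` I)"
  shows "\<exists>c. v = (\<Sum>i\<in>I. c i *\<^sub>R e i)"
  using assms(2)
proof (induction rule: span_induct_alt)
  case base
  then show ?case by (intro exI[of _ "\<lambda>_. 0"]) simp
next
  case (step c x y)
  then obtain j d where j: "j \<in> I" "x = e j" and d: "y = (\<Sum>i\<in>I. d i *\<^sub>R e i)" by auto
  have "(\<Sum>i\<in>I. (if i = j then c else 0) *\<^sub>R e i) = (\<Sum>i\<in>I. if i = j then c *\<^sub>R e j else 0)"
    by (rule sum.cong) auto
  then have "(\<Sum>i\<in>I. ((if i = j then c else 0) + d i) *\<^sub>R e i) = c *\<^sub>R x + y"
    using assms(1) j by (simp add: scaleR_left_distrib sum.distrib d)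
  then show ?case by metis
qed

text \<open>Membership in spans, instead of explicit coefficients, passes to sums, multiples and
  subsequences of blocks at once; the coefficients are recovered only here.\<close>

lemma block_basisI:
  assumes span: "\<And>n. w n \<in> span (e ` {l n..<l (Suc n)})" and nz: "\<And>n. w n \<noteq> 0"
  shows "block_basis e w"
proof -
  have "l n < l (Suc n)" for n
  proof (rule ccontr)
    assume "\<not> l n < l (Suc n)"
    then show False using span[of n] nz[of n] by simp
  qed
  then have l: "strict_mono l" by (simp add: strict_mono_Suc_iff)
  have "\<forall>n. \<exists>c. w n = (\<Sum>i\<in>{l n..<l (Suc n)}. c i *\<^sub>R e i)"
    using in_span_imageD[OF _ span] by blast
  then obtain c where c: "\<And>n. w n = (\<Sum>i\<in>{l n..<l (Suc n)}. c n i *\<^sub>R e i)" by metis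
  define a where "a i = (\<Sum>n\<le>i. if l n \<le> i \<and> i < l (Suc n) then c n i else 0)" for i
  have a: "a i = c n i" if "l n \<le> i" "i < l (Suc n)" for i n
  proof -
    have uniq: "n' = n" if "l n' \<le> i" "i < l (Suc n')" for n'
    proof -
      have "n' < Suc n" "n < Suc n'"
        using that \<open>l n \<le> i\<close> \<open>i < l (Suc n)\<close> strict_mono_less[OF l] le_less_trans by blast+
      then show ?thesis by simp
    qed
    have "(l n' \<le> i \<and> i < l (Suc n')) = (n' = n)" for n' using uniq that by blast
    moreover have "n \<le> i" using strict_mono_imp_increasing[OF l, of n] that by simp
    ultimately show ?thesis unfolding a_def by simp
  qed
  have "w n = (\<Sum>i\<in>{l n..<l (Suc n)}. a i *\<^sub>R e i)" for n
    unfolding c by (rule sum.cong) (auto simp: a[of n])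
  then show ?thesis unfolding block_basis_def using l nz by blast
qed

section \<open>A sequence in linf realising a limit of norms\<close>

lemma norm_combination_le:
  fixes u :: "nat \<Rightarrow> 'a::real_normed_vector"
  assumes "\<And>i. norm (u i) \<le> 1"
  shows "norm (\<Sum>i<m. a i *\<^sub>R u i) \<le> norm (\<Sum>i<m. b i *\<^sub>R u i) + (\<Sum>i<m. \<bar>a i - b i\<bar>)"
proof -
  have "(\<Sum>i<m. a i *\<^sub>R u i) = (\<Sum>i<m. b i *\<^sub>R u i) + (\<Sum>i<m. (a i - b i) *\<^sub>R u i)"
    by (simp add: scaleR_left_diff_distrib sum_subtractf)
  also have "norm \<dots> \<le> norm (\<Sum>i<m. b i *\<^sub>R u i) + norm (\<Sum>i<m. (a i - b i) *\<^sub>R u i)"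
    by (rule norm_triangle_ineq)
  also have "norm (\<Sum>i<m. (a i - b i) *\<^sub>R u i) \<le> (\<Sum>i<m. \<bar>a i - b i\<bar>)"
    by (rule sum_norm_le) (simp add: mult_left_le assms)
  finally show ?thesis by simp
qed

text \<open>Prepending the vector \<open>d\<close> that is to be normed to the sequence \<open>u\<close> yields a functional of norm
  one with value \<open>norm d\<close> at \<open>d\<close>. That its values on \<open>u\<close> are consistent with this one follows from
  the bound applied to the vanishing combination \<open>d - (\<Sum>i<n. q i *\<^sub>R u i)\<close>.\<close>

lemma norming_functional_at:
  fixes u :: "nat \<Rightarrow> 'b::real_normed_vector"
  obtains f where "\<And>m a. \<bar>\<Sum>i<m. a i * f i\<bar> \<le> norm (\<Sum>i<m. a i *\<^sub>R u i)"
    and "(\<Sum>i<n. q i * f i) = norm (\<Sum>i<n. q i *\<^sub>R u i)"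
proof -
  define d where "d = (\<Sum>i<n. q i *\<^sub>R u i)"
  obtain c where c0: "c 0 = norm d"
    and c: "\<And>m a. \<bar>\<Sum>i<m. a i * c i\<bar> \<le> norm (\<Sum>i<m. a i *\<^sub>R case_nat d u i)"
    using norming_functional[of "case_nat d u"] by auto
  have *: "\<bar>b * norm d + (\<Sum>i<m. a i * c (Suc i))\<bar> \<le> norm (b *\<^sub>R d + (\<Sum>i<m. a i *\<^sub>R u i))"
    for b m a
    using c[where m = "Suc m" and a = "case_nat b a"]
    by (simp add: sum.lessThan_Suc_shift c0 del: sum.lessThan_Suc)
  show ?thesis
  proof (rule that[of "\<lambda>i. c (Suc i)"])
    show "\<bar>\<Sum>i<m. a i * c (Suc i)\<bar> \<le> norm (\<Sum>i<m. a i *\<^sub>R u i)" for m a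
      using *[where b = 0] by simp
    show "(\<Sum>i<n. q i * c (Suc i)) = norm (\<Sum>i<n. q i *\<^sub>R u i)"
      using *[where b = "-1" and a = q and m = n] by (simp add: d_def)
  qed
qed

lemma pointwise_convergent_subsequence:
  fixes F :: "nat \<Rightarrow> nat \<Rightarrow> real"
  assumes "\<And>N i. \<bar>F N i\<bar> \<le> B"
  obtains r f where "strict_mono r" and "\<And>i. (\<lambda>N. F (r N) i) \<longlonglongrightarrow> f i"
proof -
  interpret subseqs "\<lambda>i s. convergent (\<lambda>N. F (s N) i)"
  proof
    fix i and s :: "nat \<Rightarrow> nat"
    have "\<forall>N. F (s N) i \<in> {-B..B}" using assms by (auto simp: abs_le_iff minus_le_iff)
    moreover have "seq_compact {-B..B}" by (rule compact_imp_seq_compact) simp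
    ultimately obtain l r' where "strict_mono r'" "((\<lambda>N. F (s N) i) \<circ> r') \<longlonglongrightarrow> l"
      using seq_compactE by metis
    then show "\<exists>r'. strict_mono r' \<and> convergent (\<lambda>N. F ((s \<circ> r') N) i)"
      by (auto simp: convergent_def o_def)
  qed
  have "convergent (\<lambda>N. F (diagseq N) i)" for i
  proof -
    have "convergent (\<lambda>N. F ((diagseq \<circ> (+) (Suc i)) N) i)"
    proof (rule diagseq_holds)
      fix r s n assume "strict_mono (r :: nat \<Rightarrow> nat)" "convergent (\<lambda>N. F (s N) n)"
      then show "convergent (\<lambda>N. F ((s \<circ> r) N) n)"
        using convergent_subseq_convergent[of "\<lambda>N. F (s N) n" r] by (simp add: o_def)
    qed
    then show ?thesis
      using convergent_ignore_initial_segment[of "\<lambda>N. F (diagseq N) i" "Suc i"]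
      by (simp add: o_def add.commute)
  qed
  then have "(\<lambda>N. F (diagseq N) i) \<longlonglongrightarrow> lim (\<lambda>N. F (diagseq N) i)" for i
    by (simp add: convergent_LIMSEQ_iff)
  with subseq_diagseq show ?thesis by (rule that)
qed

text \<open>The limit \<open>p\<close> is only a seminorm on coefficient sequences, attached to no normed space, so it
  has no norming functionals a priori. Norming functionals exist along the approximating
  sequences, and a pointwise limit of them, which exists by compactness of products of
  intervals, norms \<open>q\<close> with respect to \<open>p\<close>.\<close>

lemma limit_norm_norming_functional:
  fixes u :: "nat \<Rightarrow> nat \<Rightarrow> 'a::real_normed_vector"
  assumes u: "\<And>N i. norm (u N i) \<le> 1"
    and p: "\<And>m a. (\<lambda>N. norm (\<Sum>i<m. a i *\<^sub>R u N i)) \<longlonglongrightarrow> p m a"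
  shows "\<exists>f. (\<forall>i. \<bar>f i\<bar> \<le> 1) \<and> (\<forall>m a. \<bar>\<Sum>i<m. a i * f i\<bar> \<le> p m a) \<and>
           (\<Sum>i<n. q i * f i) = p n q"
proof -
  have "\<forall>N. \<exists>f. (\<forall>m a. \<bar>\<Sum>i<m. a i * f i\<bar> \<le> norm (\<Sum>i<m. a i *\<^sub>R u N i)) \<and>
      (\<Sum>i<n. q i * f i) = norm (\<Sum>i<n. q i *\<^sub>R u N i)"
  proof
    fix N
    obtain f where "\<And>m a. \<bar>\<Sum>i<m. a i * f i\<bar> \<le> norm (\<Sum>i<m. a i *\<^sub>R u N i)"
      and "(\<Sum>i<n. q i * f i) = norm (\<Sum>i<n. q i *\<^sub>R u N i)"
      using norming_functional_at[of "u N" q n] by blast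
    then show "\<exists>f. (\<forall>m a. \<bar>\<Sum>i<m. a i * f i\<bar> \<le> norm (\<Sum>i<m. a i *\<^sub>R u N i)) \<and>
      (\<Sum>i<n. q i * f i) = norm (\<Sum>i<n. q i *\<^sub>R u N i)" by blast
  qed
  then obtain F where
    F: "\<And>N m a. \<bar>\<Sum>i<m. a i * F N i\<bar> \<le> norm (\<Sum>i<m. a i *\<^sub>R u N i)" and
    Fq: "\<And>N. (\<Sum>i<n. q i * F N i) = norm (\<Sum>i<n. q i *\<^sub>R u N i)" by metis
  have F1: "\<bar>F N i\<bar> \<le> 1" for N i
  proof -
    have "(\<Sum>j<Suc i. (if j = i then 1 else 0) * F N j) = F N i"
      "(\<Sum>j<Suc i. (if j = i then 1 else 0) *\<^sub>R u N j) = u N i"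
      by (simp_all add: if_distrib if_distribR cong: if_cong)
    then show ?thesis
      using F[where a = "\<lambda>j. if j = i then 1 else 0" and m = "Suc i" and N = N] u[of N i] by simp
  qed
  obtain r f where r: "strict_mono r" and f: "\<And>i. (\<lambda>N. F (r N) i) \<longlonglongrightarrow> f i"
    using pointwise_convergent_subsequence[of F 1] F1 by blast
  have p': "(\<lambda>N. norm (\<Sum>i<m. a i *\<^sub>R u (r N) i)) \<longlonglongrightarrow> p m a" for m a
    using LIMSEQ_subseq_LIMSEQ[OF p[where m = m and a = a] r] by (simp add: o_def)
  have f': "(\<lambda>N. \<Sum>i<m. a i * F (r N) i) \<longlonglongrightarrow> (\<Sum>i<m. a i * f i)" for m a
    by (intro tendsto_intros f)
  have "\<bar>f i\<bar> \<le> 1" for i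
    by (rule LIMSEQ_le_const2[OF tendsto_rabs[OF f]]) (use F1 in auto)
  moreover have "\<bar>\<Sum>i<m. a i * f i\<bar> \<le> p m a" for m a
    by (rule LIMSEQ_le[OF tendsto_rabs[OF f'] p']) (use F in auto)
  moreover have "(\<Sum>i<n. q i * f i) = p n q"
    by (rule LIMSEQ_unique[OF f']) (simp add: Fq p')
  ultimately show ?thesis by blast
qed

text \<open>The \<open>k\<close>-th coordinate of the sequence in \<open>\<ell>\<^sub>\<infinity>\<close> is a functional norming the \<open>k\<close>-th rational
  combination. Real combinations follow by density, because \<open>p\<close> is Lipschitz in the coefficients.\<close>

lemma limit_norm_in_linf:
  fixes u :: "nat \<Rightarrow> nat \<Rightarrow> 'a::real_normed_vector"
  assumes u: "\<And>N i. norm (u N i) \<le> 1"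
    and p: "\<And>m a. (\<lambda>N. norm (\<Sum>i<m. a i *\<^sub>R u N i)) \<longlonglongrightarrow> p m a"
  shows "\<exists>y :: nat \<Rightarrow> linf. \<forall>m a. norm (\<Sum>i<m. a i *\<^sub>R y i) = p m a"
proof -
  define q :: "nat \<Rightarrow> nat \<Rightarrow> real" where "q k i = of_rat ((from_nat k :: rat list) ! i)" for k i
  define len where "len k = length (from_nat k :: rat list)" for k
  have "\<forall>k. \<exists>f. (\<forall>i. \<bar>f i\<bar> \<le> 1) \<and> (\<forall>m a. \<bar>\<Sum>i<m. a i * f i\<bar> \<le> p m a) \<and>
      (\<Sum>i<len k. q k i * f i) = p (len k) (q k)"
    using limit_norm_norming_functional[OF assms] by blast
  then obtain g where g1: "\<And>k i. \<bar>g k i\<bar> \<le> 1"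
    and g: "\<And>k m a. \<bar>\<Sum>i<m. a i * g k i\<bar> \<le> p m a"
    and gq: "\<And>k. (\<Sum>i<len k. q k i * g k i) = p (len k) (q k)" by metis
  define y :: "nat \<Rightarrow> linf" where "y i = Bcontfun (\<lambda>k. g k i)" for i
  have y: "apply_bcontfun (y i) k = g k i" for i k
  proof -
    have "(\<lambda>k. g k i) \<in> bcontfun" using g1 by (auto simp: bcontfun_def bounded_iff)
    then show ?thesis by (simp add: y_def Bcontfun_inverse)
  qed
  have ysum: "apply_bcontfun (\<Sum>i<m. a i *\<^sub>R y i) k = (\<Sum>i<m. a i * g k i)" for m a k
    by (induction m) (auto simp: y)
  have p_lip: "p m a \<le> p m b + (\<Sum>i<m. \<bar>a i - b i\<bar>)" for m a b
    by (rule LIMSEQ_le[OF p tendsto_add[OF p tendsto_const]])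
      (intro exI allI impI norm_combination_le u)
  have "norm (\<Sum>i<m. a i *\<^sub>R y i) = p m a" for m a
  proof (rule antisym)
    show "norm (\<Sum>i<m. a i *\<^sub>R y i) \<le> p m a"
      by (rule norm_bound) (simp add: ysum g)
    show "p m a \<le> norm (\<Sum>i<m. a i *\<^sub>R y i)"
    proof (rule field_le_epsilon)
      fix \<epsilon> :: real assume \<epsilon>: "\<epsilon> > 0"
      define \<delta> where "\<delta> = \<epsilon> / (2 * (real m + 1))"
      have \<delta>: "\<delta> > 0" using \<epsilon> by (simp add: \<delta>_def add_pos_nonneg)
      have "\<exists>r. \<bar>a i - of_rat r\<bar> \<le> \<delta>" for i
      proof -
        obtain r where "a i < of_rat r" "of_rat r < a i + \<delta>"
          using of_rat_dense[of "a i" "a i + \<delta>"] \<delta> by auto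
        then show ?thesis by (intro exI[of _ r]) linarith
      qed
      then obtain r where r: "\<And>i. \<bar>a i - of_rat (r i)\<bar> \<le> \<delta>" by metis
      define k where "k = to_nat (map r [0..<m])"
      have len: "len k = m" by (simp add: len_def k_def)
      have aq: "\<bar>a i - q k i\<bar> \<le> \<delta>" if "i < m" for i using that r by (simp add: q_def k_def)
      have "(\<Sum>i<m. \<bar>a i - q k i\<bar>) \<le> (\<Sum>i<m. \<delta>)" by (rule sum_mono) (simp add: aq)
      also have "\<dots> \<le> \<epsilon> / 2" using \<epsilon> by (simp add: \<delta>_def field_simps)
      finally have sm: "(\<Sum>i<m. \<bar>a i - q k i\<bar>) \<le> \<epsilon> / 2" .
      have "p m a \<le> p m (q k) + (\<Sum>i<m. \<bar>a i - q k i\<bar>)" by (rule p_lip)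
      also have "p m (q k) = (\<Sum>i<m. a i * g k i) - (\<Sum>i<m. (a i - q k i) * g k i)"
        using gq[of k] by (simp add: len left_diff_distrib sum_subtractf)
      also have "\<dots> \<le> norm (\<Sum>i<m. a i *\<^sub>R y i) + (\<Sum>i<m. \<bar>a i - q k i\<bar>)"
      proof -
        have "\<bar>\<Sum>i<m. (a i - q k i) * g k i\<bar> \<le> (\<Sum>i<m. \<bar>(a i - q k i) * g k i\<bar>)"
          by (rule sum_abs)
        also have "\<dots> \<le> (\<Sum>i<m. \<bar>a i - q k i\<bar>)"
          by (rule sum_mono) (simp add: abs_mult mult_left_le g1)
        finally have "\<bar>\<Sum>i<m. (a i - q k i) * g k i\<bar> \<le> (\<Sum>i<m. \<bar>a i - q k i\<bar>)" .
        moreover have "(\<Sum>i<m. a i * g k i) \<le> norm (\<Sum>i<m. a i *\<^sub>R y i)"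
          using norm_bounded[of "\<Sum>i<m. a i *\<^sub>R y i" k] by (simp add: ysum)
        ultimately show ?thesis by linarith
      qed
      finally show "p m a \<le> norm (\<Sum>i<m. a i *\<^sub>R y i) + \<epsilon>" using sm by linarith
    qed
  qed
  then show ?thesis by blast
qed

section \<open>Existence of spreading models\<close>

lemma sorted_list_of_strict_mono_image:
  fixes t :: "nat \<Rightarrow> nat"
  assumes "strict_mono_on {..<k} t"
  shows "sorted_list_of_set (t ` {..<k}) = map t [0..<k]"
proof -
  have "sorted_wrt (<) (map t [0..<k])"
    using assms by (auto simp: sorted_wrt_iff_nth_less strict_mono_on_def)
  then have "sorted_list_of_set (set (map t [0..<k])) = map t [0..<k]"
    unfolding strict_sorted_iff by (intro sorted_list_of_set.idem_if_sorted_distinct) auto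
  then show ?thesis by (simp add: atLeast0LessThan)
qed

text \<open>Ramsey's theorem, applied to a colouring of the \<open>k\<close>-element sets of indices by the rounded norms
  of the corresponding combinations. There are finitely many colours because the coefficients
  are taken from a finite grid; the Lipschitz bound extends the estimate to all coefficients
  in the unit cube.\<close>

lemma stable_norms_subsequence:
  fixes x :: "nat \<Rightarrow> 'a::real_normed_vector" and k :: nat
  assumes x: "\<And>n. norm (x n) \<le> 1" and \<epsilon>: "\<epsilon> > 0"
  shows "\<exists>r :: nat \<Rightarrow> nat. strict_mono r \<and> (\<forall>a t t'. (\<forall>i<k. \<bar>a i\<bar> \<le> 1) \<and>
           strict_mono_on {..<k} t \<and> strict_mono_on {..<k} t' \<longrightarrow>
           norm (\<Sum>i<k. a i *\<^sub>R x (r (t i))) \<le> norm (\<Sum>i<k. a i *\<^sub>R x (r (t' i))) + \<epsilon>)"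
proof -
  obtain p :: nat where p: "p > 0" "(2 * real k + 1) / \<epsilon> < real p"
    using reals_Archimedean2[of "(2 * real k + 1) / \<epsilon>"] \<epsilon>
    by (metis add_nonneg_pos divide_pos_pos gr0I mult_nonneg_nonneg not_less_iff_gr_or_eq
        of_nat_0 of_nat_0_le_iff order_less_trans zero_le_numeral zero_less_one)
  \<comment> \<open>Moving the coefficients to the grid costs \<open>k / p\<close> on either side, and norms in the same cell
    differ by at most \<open>1 / p\<close>.\<close>
  have p\<epsilon>: "(2 * real k + 1) / real p \<le> \<epsilon>"
    using p \<epsilon> by (simp add: field_simps)
  define nrm where "nrm b t = norm (\<Sum>i<k. b i *\<^sub>R x (t i))" for b and t :: "nat \<Rightarrow> nat"
  define G where "G = PiE {..<k} (\<lambda>_. {- int p..int p})"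
  define grid where "grid g i = real_of_int (g i) / real p" for g :: "nat \<Rightarrow> int" and i :: nat
  define colour where
    "colour X = restrict (\<lambda>g. \<lfloor>real p * nrm (grid g) (\<lambda>i. sorted_list_of_set X ! i)\<rfloor>) G" for X
  define Colours where "Colours = PiE G (\<lambda>_. {0..int (p * k)})"
  have finG: "finite G" unfolding G_def by (rule finite_PiE) auto
  have fin: "finite Colours" unfolding Colours_def by (rule finite_PiE) (auto simp: finG)
  have colour_in: "colour X \<in> Colours" for X
  proof -
    have "\<lfloor>real p * nrm (grid g) t\<rfloor> \<in> {0..int (p * k)}" if "g \<in> G" for g t
    proof -
      have "nrm (grid g) t \<le> (\<Sum>i<k. 1)" unfolding nrm_def
      proof (rule sum_norm_le)
        fix i assume "i \<in> {..<k}"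
        then have "\<bar>g i\<bar> \<le> int p"
          using PiE_mem[of g "{..<k}" "\<lambda>_. {- int p..int p}" i] that by (simp add: G_def abs_le_iff)
        then have "\<bar>real_of_int (g i)\<bar> \<le> real p" by linarith
        then have "\<bar>grid g i\<bar> \<le> 1" using p by (simp add: grid_def)
        then show "norm (grid g i *\<^sub>R x (t i)) \<le> 1" using x[of "t i"] by (simp add: mult_le_one)
      qed
      then have "real p * nrm (grid g) t \<le> real p * real k" by (intro mult_left_mono) auto
      then have "\<lfloor>real p * nrm (grid g) t\<rfloor> \<le> int (p * k)" by (simp add: floor_le_iff)
      moreover have "0 \<le> real p * nrm (grid g) t" by (simp add: nrm_def)
      ultimately show ?thesis by simp
    qed
    then show ?thesis unfolding Colours_def colour_def by auto
  qed
  obtain enc :: "_ \<Rightarrow> nat" and s where enc: "enc ` Colours = {i. i < s}" "inj_on enc Colours"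
    using finite_imp_inj_to_nat_seg[OF fin] by blast
  have "\<forall>X. X \<subseteq> UNIV \<and> finite X \<and> card X = k \<longrightarrow> (enc \<circ> colour) X < s"
    using enc(1) colour_in by auto
  from Ramsey[OF infinite_UNIV_nat this] obtain Y c where Y: "infinite Y"
    and c: "\<And>X. X \<subseteq> Y \<Longrightarrow> finite X \<Longrightarrow> card X = k \<Longrightarrow> enc (colour X) = c" by auto
  define r where "r = enumerate Y"
  have r: "strict_mono r" "range r = Y"
    using strict_mono_enumerate[OF Y] range_enumerate[OF Y] by (auto simp: r_def)
  \<comment> \<open>Applying \<open>enumerate\<close> to positions turns increasing tuples of positions into subsets of \<open>Y\<close>,
    which all have the same colour.\<close>
  have cells: "\<lfloor>real p * nrm (grid g) (\<lambda>i. r (t i))\<rfloor> = \<lfloor>real p * nrm (grid g) (\<lambda>i. r (t' i))\<rfloor>"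
    if g: "g \<in> G" and t: "strict_mono_on {..<k} t" "strict_mono_on {..<k} t'" for g t t'
  proof -
    have *: "enc (colour ((r \<circ> t) ` {..<k})) = c \<and>
        colour ((r \<circ> t) ` {..<k}) g = \<lfloor>real p * nrm (grid g) (\<lambda>i. r (t i))\<rfloor>"
      if t: "strict_mono_on {..<k} t" for t
    proof -
      have rt: "strict_mono_on {..<k} (r \<circ> t)"
        using t r(1) by (auto simp: strict_mono_on_def strict_mono_def)
      have "card ((r \<circ> t) ` {..<k}) = k"
        using card_image[OF strict_mono_on_imp_inj_on[OF rt]] by simp
      then have "enc (colour ((r \<circ> t) ` {..<k})) = c" using r(2) by (intro c) auto
      moreover have "colour ((r \<circ> t) ` {..<k}) g = \<lfloor>real p * nrm (grid g) (\<lambda>i. r (t i))\<rfloor>"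
        unfolding colour_def sorted_list_of_strict_mono_image[OF rt] using g by (simp add: nrm_def)
      ultimately show ?thesis by blast
    qed
    have "colour ((r \<circ> t) ` {..<k}) = colour ((r \<circ> t') ` {..<k})"
      using inj_onD[OF enc(2) _ colour_in colour_in] *[OF t(1)] *[OF t(2)] by metis
    then show ?thesis using *[OF t(1)] *[OF t(2)] by metis
  qed
  have "norm (\<Sum>i<k. a i *\<^sub>R x (r (t i))) \<le> norm (\<Sum>i<k. a i *\<^sub>R x (r (t' i))) + \<epsilon>"
    if a: "\<forall>i<k. \<bar>a i\<bar> \<le> 1" and t: "strict_mono_on {..<k} t" "strict_mono_on {..<k} t'" for a t t'
  proof -
    define g where "g = restrict (\<lambda>i. \<lfloor>real p * a i\<rfloor>) {..<k}"
    have "\<lfloor>real p * a i\<rfloor> \<in> {- int p..int p}" if "i < k" for i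
    proof -
      have "\<bar>a i\<bar> \<le> 1" using a that by blast
      then have "real p * a i \<le> real p * 1" "real p * (-1) \<le> real p * a i"
        by (intro mult_left_mono; simp add: abs_le_iff)+
      then show ?thesis by (simp add: floor_le_iff le_floor_iff)
    qed
    then have g: "g \<in> G" by (auto simp: g_def G_def)
    have ag: "\<bar>a i - grid g i\<bar> \<le> 1 / real p" if "i < k" for i
    proof -
      have "a i - grid g i = (real p * a i - of_int \<lfloor>real p * a i\<rfloor>) / real p"
        using p that by (simp add: grid_def g_def field_simps)
      moreover have "\<bar>real p * a i - of_int \<lfloor>real p * a i\<rfloor>\<bar> \<le> 1" by linarith
      ultimately show ?thesis using p by (simp add: divide_right_mono)
    qed
    have "(\<Sum>i<k. \<bar>a i - grid g i\<bar>) \<le> (\<Sum>i<k. 1 / real p)" by (rule sum_mono) (simp add: ag)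
    then have sm: "(\<Sum>i<k. \<bar>a i - grid g i\<bar>) \<le> real k / real p" by simp
    have "real p * nrm (grid g) (\<lambda>i. r (t i)) \<le> real p * nrm (grid g) (\<lambda>i. r (t' i)) + 1"
      using cells[OF g t] by linarith
    then have cell: "nrm (grid g) (\<lambda>i. r (t i)) \<le> nrm (grid g) (\<lambda>i. r (t' i)) + 1 / real p"
      using p by (simp add: field_simps)
    have "nrm a (\<lambda>i. r (t i)) \<le> nrm (grid g) (\<lambda>i. r (t i)) + real k / real p"
      using norm_combination_le[of "\<lambda>i. x (r (t i))" a k "grid g"] x sm unfolding nrm_def by force
    moreover have "nrm (grid g) (\<lambda>i. r (t' i)) \<le> nrm a (\<lambda>i. r (t' i)) + real k / real p"
      using norm_combination_le[of "\<lambda>i. x (r (t' i))" "grid g" k a] x sm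
      unfolding nrm_def by (force simp: abs_minus_commute)
    moreover have "real k / real p + real k / real p + 1 / real p \<le> \<epsilon>"
      using p\<epsilon> by (simp add: add_divide_distrib)
    ultimately show ?thesis using cell unfolding nrm_def by linarith
  qed
  then show ?thesis using r(1) by (intro exI[of _ r]) simp
qed

text \<open>The Brunel--Sucheston theorem. The stabilisation is carried out successively for all pairs
  of a length \<open>k\<close> and an accuracy \<open>1 / (p + 1)\<close>, coded as natural numbers, and the diagonal
  subsequence inherits each of them from some position on. The norms of combinations then
  converge along translates, which gives the limit norm that is realised in \<open>\<ell>\<^sub>\<infinity>\<close>.\<close>

theorem ex_spreading_model_subsequence:
  fixes x :: "nat \<Rightarrow> 'a::real_normed_vector"
  assumes x: "\<And>n. norm (x n) \<le> 1"
  obtains h and y :: "nat \<Rightarrow> linf" where "strict_mono h" and "spreading_model (x \<circ> h) y"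
proof -
  define P :: "nat \<Rightarrow> (nat \<Rightarrow> nat) \<Rightarrow> bool" where
    "P n s \<longleftrightarrow> (case prod_decode n of (k, p) \<Rightarrow> \<forall>a t t'. (\<forall>i<k. \<bar>a i\<bar> \<le> 1) \<and>
       strict_mono_on {..<k} t \<and> strict_mono_on {..<k} t' \<longrightarrow>
       norm (\<Sum>i<k. a i *\<^sub>R x (s (t i))) \<le> norm (\<Sum>i<k. a i *\<^sub>R x (s (t' i))) + 1 / (real p + 1))"
    for n s
  interpret subseqs P
  proof
    fix n and s :: "nat \<Rightarrow> nat"
    obtain k p where n: "prod_decode n = (k, p)" by fastforce
    show "\<exists>r. strict_mono r \<and> P n (s \<circ> r)"
      using stable_norms_subsequence[of "x \<circ> s" "1 / (real p + 1)" k] x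
      by (simp add: P_def n add_pos_nonneg)
  qed
  define h where "h = diagseq"
  have h: "strict_mono h" using subseq_diagseq by (simp add: h_def)
  define start where "start k p = Suc (prod_encode (k, p))" for k p
  have stable: "norm (\<Sum>i<k. a i *\<^sub>R x (h (t i))) \<le> norm (\<Sum>i<k. a i *\<^sub>R x (h (t' i))) + 1 / (real p + 1)"
    if a: "\<forall>i<k. \<bar>a i\<bar> \<le> 1" and t: "strict_mono_on {..<k} t" "\<forall>i<k. start k p \<le> t i"
      and t': "strict_mono_on {..<k} t'" "\<forall>i<k. start k p \<le> t' i" for k p a t t'
  proof -
    have "P n (s \<circ> r)" if "strict_mono r" "P n s" for r s n
    proof -
      have "strict_mono_on {..<k} (\<lambda>i. r (t i))" if "strict_mono_on {..<k} t" for k :: nat and t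
        using that \<open>strict_mono r\<close> by (auto simp: strict_mono_on_def strict_mono_def)
      moreover obtain k p where "prod_decode n = (k, p)" by fastforce
      ultimately show ?thesis using \<open>P n s\<close> unfolding P_def by simp
    qed
    then have "P (prod_encode (k, p)) (h \<circ> (+) (start k p))"
      unfolding h_def start_def by (rule diagseq_holds)
    moreover have "strict_mono_on {..<k} (\<lambda>i. t i - start k p)"
      "strict_mono_on {..<k} (\<lambda>i. t' i - start k p)"
      using t t' by (auto simp: strict_mono_on_def intro!: diff_less_mono)
    ultimately have "norm (\<Sum>i<k. a i *\<^sub>R x (h (start k p + (t i - start k p)))) \<le>
        norm (\<Sum>i<k. a i *\<^sub>R x (h (start k p + (t' i - start k p)))) + 1 / (real p + 1)"
      using a unfolding P_def by simp
    moreover have "(\<Sum>i<k. a i *\<^sub>R x (h (start k p + (s i - start k p)))) = (\<Sum>i<k. a i *\<^sub>R x (h (s i)))"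
      if "\<forall>i<k. start k p \<le> s i" for s
      by (rule sum.cong) (use that in auto)
    ultimately show ?thesis using t(2) t'(2) by simp
  qed
  define u where "u N i = x (h (N + i))" for N i
  have shift: "strict_mono_on {..<k} (\<lambda>i. N + i)" for k N :: nat by (auto simp: strict_mono_on_def)
  have conv1: "convergent (\<lambda>N. norm (\<Sum>i<k. a i *\<^sub>R u N i))" if a: "\<forall>i<k. \<bar>a i\<bar> \<le> 1" for k a
    unfolding Cauchy_convergent_iff[symmetric]
  proof (rule metric_CauchyI)
    fix \<epsilon> :: real assume "\<epsilon> > 0"
    then obtain p where p: "1 / (real p + 1) < \<epsilon>" using nat_approx_posE
      by (metis of_nat_Suc add.commute)
    have close: "norm (\<Sum>i<k. a i *\<^sub>R u N i) \<le> norm (\<Sum>i<k. a i *\<^sub>R u N' i) + 1 / (real p + 1)"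
      if "start k p \<le> N" "start k p \<le> N'" for N N'
      unfolding u_def by (rule stable[OF a shift _ shift]) (use that in auto)
    have "dist (norm (\<Sum>i<k. a i *\<^sub>R u N i)) (norm (\<Sum>i<k. a i *\<^sub>R u N' i)) < \<epsilon>"
      if "start k p \<le> N" "start k p \<le> N'" for N N'
      using close[OF that] close[OF that(2,1)] p unfolding dist_real_def by linarith
    then show "\<exists>M. \<forall>m\<ge>M. \<forall>n\<ge>M. dist (norm (\<Sum>i<k. a i *\<^sub>R u m i)) (norm (\<Sum>i<k. a i *\<^sub>R u n i)) < \<epsilon>"
      by blast
  qed
  \<comment> \<open>The stability estimate covers coefficients bounded by 1; others are scaled down.\<close>
  have conv: "convergent (\<lambda>N. norm (\<Sum>i<k. a i *\<^sub>R u N i))" for k a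
  proof -
    define c where "c = (\<Sum>i<k. \<bar>a i\<bar>) + 1"
    have c: "c > 0" unfolding c_def by (intro add_nonneg_pos sum_nonneg) auto
    have "\<bar>a i\<bar> \<le> c" if "i < k" for i
    proof -
      have "\<bar>a i\<bar> \<le> (\<Sum>i<k. \<bar>a i\<bar>)" by (rule member_le_sum) (use that in auto)
      then show ?thesis by (simp add: c_def)
    qed
    then have "convergent (\<lambda>N. c * norm (\<Sum>i<k. (a i / c) *\<^sub>R u N i))"
      using c by (intro convergent_mult convergent_const conv1) simp
    moreover have "c * norm (\<Sum>i<k. (a i / c) *\<^sub>R u N i) = norm (\<Sum>i<k. a i *\<^sub>R u N i)" for N
    proof -
      have "c *\<^sub>R (\<Sum>i<k. (a i / c) *\<^sub>R u N i) = (\<Sum>i<k. a i *\<^sub>R u N i)"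
        unfolding scaleR_sum_right by (rule sum.cong) (use c in auto)
      then show ?thesis using c by (metis abs_of_pos norm_scaleR)
    qed
    ultimately show ?thesis by simp
  qed
  then have lim: "(\<lambda>N. norm (\<Sum>i<k. a i *\<^sub>R u N i)) \<longlonglongrightarrow> lim (\<lambda>N. norm (\<Sum>i<k. a i *\<^sub>R u N i))"
    for k a by (simp add: convergent_LIMSEQ_iff)
  have "norm (u N i) \<le> 1" for N i by (simp add: u_def x)
  from limit_norm_in_linf[OF this lim] obtain y :: "nat \<Rightarrow> linf" where
    y: "\<And>k a. norm (\<Sum>i<k. a i *\<^sub>R y i) = lim (\<lambda>N. norm (\<Sum>i<k. a i *\<^sub>R u N i))" by blast
  have "spreading_model (x \<circ> h) y"
    unfolding spreading_model_def
  proof (intro allI impI)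
    fix \<epsilon> :: real and k :: nat assume "\<epsilon> > 0"
    then obtain p where p: "1 / (real p + 1) < \<epsilon>" using nat_approx_posE
      by (metis of_nat_Suc add.commute)
    have "\<bar>norm (\<Sum>i<k. a i *\<^sub>R (x \<circ> h) (s i)) - norm (\<Sum>i<k. a i *\<^sub>R y i)\<bar> < \<epsilon>"
      if s: "strict_mono_on {..<k} s" "\<forall>i<k. start k p \<le> s i" and a: "\<forall>i<k. \<bar>a i\<bar> \<le> 1" for s a
    proof -
      let ?n = "norm (\<Sum>i<k. a i *\<^sub>R x (h (s i)))"
      have "\<bar>?n - norm (\<Sum>i<k. a i *\<^sub>R u N i)\<bar> \<le> 1 / (real p + 1)" if "start k p \<le> N" for N
      proof -
        have N: "\<forall>i<k. start k p \<le> N + i" using that by auto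
        show ?thesis
          using stable[OF a s shift N] stable[OF a shift N s] unfolding u_def by linarith
      qed
      then have "\<bar>?n - lim (\<lambda>N. norm (\<Sum>i<k. a i *\<^sub>R u N i))\<bar> \<le> 1 / (real p + 1)"
        by (intro LIMSEQ_le_const2[OF tendsto_rabs[OF tendsto_diff[OF tendsto_const lim]]]) blast
      then show ?thesis using p by (simp add: y)
    qed
    then show "\<exists>n. \<forall>s a. strict_mono_on {..<k} s \<and> (\<forall>i<k. n \<le> s i) \<and> (\<forall>i<k. \<bar>a i\<bar> \<le> 1) \<longrightarrow>
        \<bar>norm (\<Sum>i<k. a i *\<^sub>R (x \<circ> h) (s i)) - norm (\<Sum>i<k. a i *\<^sub>R y i)\<bar> < \<epsilon>" by blast
  qed
  with h show ?thesis by (rule that)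
qed

lemma spreading_model_norm_limit:
  assumes "spreading_model x y" and a: "\<forall>i<k. \<bar>a i\<bar> \<le> 1"
  shows "(\<lambda>N. norm (\<Sum>i<k. a i *\<^sub>R x (N + i))) \<longlonglongrightarrow> norm (\<Sum>i<k. a i *\<^sub>R y i)"
proof (rule LIMSEQ_I)
  fix \<epsilon> :: real assume "\<epsilon> > 0"
  then obtain n where n: "\<And>s :: nat \<Rightarrow> nat. strict_mono_on {..<k} s \<Longrightarrow> \<forall>i<k. n \<le> s i \<Longrightarrow>
      \<bar>norm (\<Sum>i<k. a i *\<^sub>R x (s i)) - norm (\<Sum>i<k. a i *\<^sub>R y i)\<bar> < \<epsilon>"
    using assms unfolding spreading_model_def by meson
  have "norm (norm (\<Sum>i<k. a i *\<^sub>R x (N + i)) - norm (\<Sum>i<k. a i *\<^sub>R y i)) < \<epsilon>" if "n \<le> N" for N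
    unfolding real_norm_def by (rule n) (use that in \<open>auto simp: strict_mono_on_def\<close>)
  then show "\<exists>n. \<forall>N\<ge>n. norm (norm (\<Sum>i<k. a i *\<^sub>R x (N + i)) - norm (\<Sum>i<k. a i *\<^sub>R y i)) < \<epsilon>"
    by blast
qed

text \<open>The two equivalence constants satisfy \<open>A * B \<le> K\<close>; since \<open>y 0\<close> is a unit vector, \<open>B \<ge> 1\<close>, hence
  the constant \<open>A\<close> of the lower estimate is at most \<open>K\<close>.\<close>

lemma K_equivalent_l1_lower_bound:
  assumes "K_equivalent K y l1_unit" and y0: "norm (y 0) = 1"
  shows "K > 0" and "real N \<le> K * norm (\<Sum>i<N. y i)"
proof -
  obtain A B where AB: "A > 0" "B > 0" "A * B \<le> K" and
    eq: "\<forall>a :: nat \<Rightarrow> real. finite {i. a i \<noteq> 0} \<longrightarrow>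
           inverse A * norm (\<Sum>i | a i \<noteq> 0. a i *\<^sub>R l1_unit i) \<le> norm (\<Sum>i | a i \<noteq> 0. a i *\<^sub>R y i) \<and>
           norm (\<Sum>i | a i \<noteq> 0. a i *\<^sub>R y i) \<le> B * norm (\<Sum>i | a i \<noteq> 0. a i *\<^sub>R l1_unit i)"
    using assms(1) unfolding K_equivalent_def by blast
  have eqN: "inverse A * real N \<le> norm (\<Sum>i<N. y i) \<and> norm (\<Sum>i<N. y i) \<le> B * real N" for N
  proof -
    let ?a = "\<lambda>i. if i < N then 1 else (0 :: real)"
    have supp: "{i. ?a i \<noteq> 0} = {..<N}" by auto
    have "norm (\<Sum>i<N. ?a i *\<^sub>R l1_unit i) = real N" by (subst norm_sum_l1_unit) simp_all
    moreover have "(\<Sum>i<N. ?a i *\<^sub>R y i) = (\<Sum>i<N. y i)" by (rule sum.cong) auto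
    ultimately show ?thesis using eq[rule_format, of ?a] unfolding supp by simp
  qed
  show "K > 0" using AB mult_pos_pos[of A B] by linarith
  have "1 \<le> B" using eqN[of 1] y0 by simp
  then have "A \<le> K" using AB mult_left_mono[of 1 B A] by linarith
  have "real N \<le> A * norm (\<Sum>i<N. y i)"
    using eqN[of N] AB(1) by (simp add: field_simps)
  also have "\<dots> \<le> K * norm (\<Sum>i<N. y i)" using \<open>A \<le> K\<close> by (rule mult_right_mono) simp
  finally show "real N \<le> K * norm (\<Sum>i<N. y i)" .
qed

section \<open>Regrouping along diagonals\<close>

lemma norm_shifted_sum_diff:
  fixes f :: "nat \<Rightarrow> 'a::real_normed_vector"
  assumes "\<And>j. norm (f j) \<le> M"
  shows "norm ((\<Sum>j<N. f (j + i)) - (\<Sum>j<N. f j)) \<le> 2 * real i * M"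
proof (induction i)
  case (Suc i)
  have "(\<Sum>j<N. f (j + Suc i)) - (\<Sum>j<N. f (j + i)) = f (N + i) - f i"
    using sum_lessThan_telescope[of "\<lambda>j. f (j + i)" N] by (simp add: sum_subtractf)
  then have "(\<Sum>j<N. f (j + Suc i)) - (\<Sum>j<N. f j) =
      ((\<Sum>j<N. f (j + i)) - (\<Sum>j<N. f j)) + (f (N + i) - f i)"
    by (simp add: algebra_simps)
  also have "norm \<dots> \<le> 2 * real i * M + (M + M)"
    using norm_triangle_mono[OF Suc.IH norm_triangle_le_diff[of "f (N + i)" "f i" "M + M"]]
      add_mono[OF assms assms] by blast
  finally show ?case by (simp add: algebra_simps)
qed simp

text \<open>For each \<open>i\<close> the diagonals use the window \<open>i, \<dots>, i + N - 1\<close> of the sequence \<open>X (\<sigma> i)\<close> instead of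
  \<open>0, \<dots>, N - 1\<close>. These windows differ in at most \<open>2 * i\<close> terms, however large \<open>N\<close> is.\<close>

lemma norm_sum_le_diagonals:
  fixes X :: "nat \<Rightarrow> nat \<Rightarrow> 'a::real_normed_vector"
  assumes M: "\<And>i j. i \<in> {1..m} \<Longrightarrow> norm (X i j) \<le> M"
    and \<sigma>: "\<sigma> permutes {1..m}"
    and D: "\<And>j. norm (\<Sum>i\<in>{1..m}. X (\<sigma> i) (j + i)) \<le> D"
  shows "norm (\<Sum>j<N. \<Sum>i\<in>{1..m}. X i j) \<le> real N * D + 2 * real m * real m * M"
proof -
  define \<Delta> where "\<Delta> i = (\<Sum>j<N. X (\<sigma> i) (j + i)) - (\<Sum>j<N. X (\<sigma> i) j)" for i
  have \<Delta>: "norm (\<Delta> i) \<le> 2 * real m * M" if i: "i \<in> {1..m}" for i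
  proof -
    have \<sigma>i: "\<sigma> i \<in> {1..m}" using permutes_in_image[OF \<sigma>] i by blast
    have "norm (\<Delta> i) \<le> 2 * real i * M"
      unfolding \<Delta>_def by (rule norm_shifted_sum_diff) (rule M[OF \<sigma>i])
    also have "\<dots> \<le> 2 * real m * M"
      using i order_trans[OF norm_ge_zero M[OF i]] by (intro mult_right_mono) auto
    finally show ?thesis .
  qed
  have "(\<Sum>j<N. \<Sum>i\<in>{1..m}. X i j) = (\<Sum>i\<in>{1..m}. \<Sum>j<N. X i j)" by (rule sum.swap)
  also have "\<dots> = (\<Sum>i\<in>{1..m}. \<Sum>j<N. X (\<sigma> i) j)"
    using sum.permute[OF \<sigma>, of "\<lambda>i. \<Sum>j<N. X i j"] by (simp add: o_def)
  also have "\<dots> = (\<Sum>i\<in>{1..m}. (\<Sum>j<N. X (\<sigma> i) (j + i)) - \<Delta> i)" by (simp add: \<Delta>_def)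
  also have "\<dots> = (\<Sum>j<N. \<Sum>i\<in>{1..m}. X (\<sigma> i) (j + i)) - (\<Sum>i\<in>{1..m}. \<Delta> i)"
    unfolding sum_subtractf by (subst sum.swap) (rule refl)
  also have "norm \<dots> \<le> (\<Sum>j<N. D) + (\<Sum>i\<in>{1..m}. 2 * real m * M)"
    by (intro order_trans[OF norm_triangle_ineq4] add_mono sum_norm_le D \<Delta>)
  finally show ?thesis by (simp add: algebra_simps)
qed

section \<open>Block asymptotic symmetry\<close>

text \<open>All indices are taken from one fast growing sequence \<open>\<kappa>\<close>, arranged in consecutive groups of
  length \<open>m\<close>: the \<open>i\<close>-th block basis uses the \<open>i\<close>-th entry of each group. Within a group the
  indices grow in the natural order, which gives the limit \<open>L\<close>. If instead the entry \<open>\<sigma> i\<close> is taken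
  from the \<open>i\<close>-th of \<open>m\<close> successive groups, the indices grow in the order \<open>\<sigma> 1, \<dots>, \<sigma> m\<close>,
  whatever \<open>\<sigma>\<close> is, which gives the limit \<open>R\<close>.\<close>

lemma ex_fast_block_subsequences:
  fixes e :: "nat \<Rightarrow> 'a::banach" and x :: "nat \<Rightarrow> nat \<Rightarrow> 'a"
  assumes m: "m > 0"
    and blk: "\<And>i. i \<in> {1..m} \<Longrightarrow> block_basis e (x i)"
    and \<sigma>: "\<sigma> permutes {1..m}"
    and L: "has_iterated_limit [1..<Suc m] (\<lambda>n. norm (\<Sum>i\<in>{1..m}. x i (n i))) L"
    and R: "has_iterated_limit (map \<sigma> [1..<Suc m]) (\<lambda>n. norm (\<Sum>i\<in>{1..m}. x i (n i))) R"
  obtains \<rho> :: "nat \<Rightarrow> nat \<Rightarrow> nat" and l :: "nat \<Rightarrow> nat" where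
    "\<And>n. (\<Sum>i\<in>{1..m}. x i (\<rho> i n)) \<in> span (e ` {l n..<l (Suc n)})" "strict_mono l"
    "\<And>n. \<bar>norm (\<Sum>i\<in>{1..m}. x i (\<rho> i n)) - L\<bar> \<le> 1 / (real n + 1)"
    "\<And>g. strict_mono g \<Longrightarrow>
       \<bar>norm (\<Sum>i\<in>{1..m}. x (\<sigma> i) (\<rho> (\<sigma> i) (g i))) - R\<bar> \<le> 1 / (real (g 0) + 1)"
proof -
  let ?f = "\<lambda>n. norm (\<Sum>i\<in>{1..m}. x i (n i))"
  have "\<forall>i\<in>{1..m}. \<exists>p a. strict_mono (p :: nat \<Rightarrow> nat) \<and>
      (\<forall>k. x i k = (\<Sum>j\<in>{p k..<p (Suc k)}. a j *\<^sub>R e j))"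
    using blk unfolding block_basis_def by blast
  then obtain p a where p: "\<And>i. i \<in> {1..m} \<Longrightarrow> strict_mono (p i :: nat \<Rightarrow> nat)"
    and x: "\<And>i k. i \<in> {1..m} \<Longrightarrow> x i k = (\<Sum>j\<in>{p i k..<p i (Suc k)}. a i j *\<^sub>R e j)"
    unfolding bchoice_iff by blast
  obtain \<theta>L :: "nat \<Rightarrow> nat" where \<theta>L:
    "\<And>M n. sorted_wrt (\<lambda>a b. \<theta>L a \<le> b) (M # map n [1..<Suc m]) \<Longrightarrow> \<bar>?f n - L\<bar> \<le> 1 / (real M + 1)"
    using iterated_limit_along_fast_indices[OF L] by blast
  obtain \<theta>R :: "nat \<Rightarrow> nat" where \<theta>R:
    "\<And>M n. sorted_wrt (\<lambda>a b. \<theta>R a \<le> b) (M # map n (map \<sigma> [1..<Suc m])) \<Longrightarrow>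
       \<bar>?f n - R\<bar> \<le> 1 / (real M + 1)"
    using iterated_limit_along_fast_indices[OF R] by blast
  \<comment> \<open>The last summand exceeds the right end of the support of every \<open>x i v\<close>, so that later
    values of \<open>\<kappa>\<close> lie beyond it.\<close>
  define \<theta> where "\<theta> v = \<theta>L v + \<theta>R v + (\<Sum>i\<in>{1..m}. p i (Suc v))" for v
  obtain \<kappa> :: "nat \<Rightarrow> nat" where \<kappa>: "strict_mono \<kappa>" and fast: "\<And>r s. r < s \<Longrightarrow> \<theta> (\<kappa> r) \<le> \<kappa> s"
    using fast_growing_sequence[of \<theta>] by blast
  have \<kappa>_ge: "r \<le> \<kappa> r" for r using strict_mono_imp_increasing[OF \<kappa>] .
  have sorted: "sorted_wrt (\<lambda>a b. \<theta>L a \<le> b) (map \<kappa> rs)" "sorted_wrt (\<lambda>a b. \<theta>R a \<le> b) (map \<kappa> rs)"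
    if "sorted_wrt (<) rs" for rs
  proof -
    have "\<theta>L (\<kappa> r) \<le> \<kappa> s" "\<theta>R (\<kappa> r) \<le> \<kappa> s" if "r < s" for r s
      using fast[OF that] by (simp_all add: \<theta>_def)
    then show "sorted_wrt (\<lambda>a b. \<theta>L a \<le> b) (map \<kappa> rs)" "sorted_wrt (\<lambda>a b. \<theta>R a \<le> b) (map \<kappa> rs)"
      unfolding sorted_wrt_map using sorted_wrt_mono_rel[OF _ that] by auto
  qed
  \<comment> \<open>Group \<open>n\<close> consists of the entries \<open>n * m + 1, \<dots>, n * m + m\<close>; the entry \<open>n * m\<close> before it
    serves as the initial value that controls the accuracy.\<close>
  define \<rho> where "\<rho> i n = \<kappa> (n * m + i)" for i n
  define l where "l n = \<kappa> (n * m + 1)" for n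
  have close: "1 / (real (\<kappa> r) + 1) \<le> 1 / (real n + 1)" if "n \<le> r" for n r
    using that \<kappa>_ge[of r] by (intro divide_left_mono) (auto simp: add_pos_nonneg)
  have "(\<Sum>i\<in>{1..m}. x i (\<rho> i n)) \<in> span (e ` {l n..<l (Suc n)})" for n
  proof (rule span_sum)
    fix i assume i: "i \<in> {1..m}"
    have "l n \<le> \<rho> i n" unfolding l_def \<rho>_def using strict_mono_less_eq[OF \<kappa>] i by simp
    also have "\<dots> \<le> p i (\<rho> i n)" using strict_mono_imp_increasing[OF p[OF i]] .
    finally have lower: "l n \<le> p i (\<rho> i n)" .
    have "p i (Suc (\<rho> i n)) \<le> (\<Sum>k\<in>{1..m}. p k (Suc (\<rho> i n)))"
      by (rule member_le_sum[OF i]) auto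
    also have "\<dots> \<le> \<theta> (\<rho> i n)" by (simp add: \<theta>_def)
    also have "\<dots> \<le> l (Suc n)" unfolding l_def \<rho>_def by (rule fast) (use i in auto)
    finally have upper: "p i (Suc (\<rho> i n)) \<le> l (Suc n)" .
    show "x i (\<rho> i n) \<in> span (e ` {l n..<l (Suc n)})"
      unfolding x[OF i] by (intro span_sum span_scale span_base) (use lower upper in auto)
  qed
  moreover have "strict_mono l"
    unfolding strict_mono_Suc_iff l_def using m strict_mono_less[OF \<kappa>] by simp
  moreover have "\<bar>norm (\<Sum>i\<in>{1..m}. x i (\<rho> i n)) - L\<bar> \<le> 1 / (real n + 1)" for n
  proof -
    have "sorted_wrt (<) (n * m # map (\<lambda>i. n * m + i) [1..<Suc m])"
      by (auto simp: sorted_wrt_map simp del: upt_Suc)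
    from sorted(1)[OF this]
    have "sorted_wrt (\<lambda>a b. \<theta>L a \<le> b) (\<kappa> (n * m) # map (\<lambda>i. \<rho> i n) [1..<Suc m])"
      by (simp add: \<rho>_def o_def del: upt_Suc)
    from \<theta>L[OF this] close[of n "n * m"] m show ?thesis by simp
  qed
  moreover have "\<bar>norm (\<Sum>i\<in>{1..m}. x (\<sigma> i) (\<rho> (\<sigma> i) (g i))) - R\<bar> \<le> 1 / (real (g 0) + 1)"
    if g: "strict_mono g" for g
  proof -
    define n where "n s = \<rho> s (g (inv \<sigma> s))" for s
    have n\<sigma>: "n (\<sigma> i) = \<rho> (\<sigma> i) (g i)" for i
      by (simp add: n_def permutes_inverses(2)[OF \<sigma>])
    have \<sigma>1: "1 \<le> \<sigma> i \<and> \<sigma> i \<le> m" if "1 \<le> i" "i \<le> m" for i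
      using permutes_in_image[OF \<sigma>, of i] that by simp
    \<comment> \<open>The bound \<open>s \<le> m\<close> includes \<open>s = 0\<close>, which stands for the initial value.\<close>
    have step: "g i * m + s < g j * m + \<sigma> j" if "i < j" "s \<le> m" "1 \<le> j" "j \<le> m" for i j s
    proof -
      have "Suc (g i) * m \<le> g j * m"
        using strict_monoD[OF g \<open>i < j\<close>] by (intro mult_right_mono) auto
      then show ?thesis using \<sigma>1[OF that(3,4)] that(2) by simp
    qed
    have "sorted_wrt (<) (map (\<lambda>i. g i * m + \<sigma> i) [1..<Suc m])"
      unfolding sorted_wrt_map
    proof (rule sorted_wrt_mono_rel[OF _ sorted_wrt_upt])
      fix i j assume "i \<in> set [1..<Suc m]" "j \<in> set [1..<Suc m]" "i < j"
      then show "g i * m + \<sigma> i < g j * m + \<sigma> j" using \<sigma>1[of i] by (intro step) auto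
    qed
    then have "sorted_wrt (<) (g 0 * m # map (\<lambda>i. g i * m + \<sigma> i) [1..<Suc m])"
      using step[of 0 _ 0] by (auto simp del: upt_Suc)
    from sorted(2)[OF this]
    have "sorted_wrt (\<lambda>a b. \<theta>R a \<le> b) (\<kappa> (g 0 * m) # map n (map \<sigma> [1..<Suc m]))"
      by (simp add: n\<sigma> \<rho>_def o_def del: upt_Suc)
    from \<theta>R[OF this] have "\<bar>?f n - R\<bar> \<le> 1 / (real (\<kappa> (g 0 * m)) + 1)" .
    moreover have "(\<Sum>i\<in>{1..m}. x i (n i)) = (\<Sum>i\<in>{1..m}. x (\<sigma> i) (\<rho> (\<sigma> i) (g i)))"
      using sum.permute[OF \<sigma>, of "\<lambda>i. x i (n i)"] by (simp add: o_def n\<sigma>)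
    ultimately show ?thesis using close[of "g 0" "g 0 * m"] m by simp
  qed
  ultimately show ?thesis by (rule that)
qed

text \<open>Positivity of \<open>L\<close> ensures that the sums \<open>W n\<close> are eventually nonzero with norms bounded away
  from 0, so that they can be normalised. The spreading model is obtained for the normalised
  vectors, and its lower \<open>\<ell>\<^sub>1\<close> estimate is compared with the upper estimate along diagonals.\<close>

lemma iterated_limit_le_permuted:
  fixes e :: "nat \<Rightarrow> 'a::banach" and x :: "nat \<Rightarrow> nat \<Rightarrow> 'a"
  assumes l1: "\<And>(x :: nat \<Rightarrow> 'a) (y :: nat \<Rightarrow> linf).
      block_basis e x \<Longrightarrow> normalized x \<Longrightarrow> spreading_model x y \<Longrightarrow> K_equivalent K y l1_unit"
    and blk: "\<And>i. i \<in> {1..m} \<Longrightarrow> block_basis e (x i) \<and> bounded (range (x i))"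
    and \<sigma>: "\<sigma> permutes {1..m}"
    and L: "has_iterated_limit [1..<Suc m] (\<lambda>n. norm (\<Sum>i\<in>{1..m}. x i (n i))) L"
    and R: "has_iterated_limit (map \<sigma> [1..<Suc m]) (\<lambda>n. norm (\<Sum>i\<in>{1..m}. x i (n i))) R"
    and pos: "L > 0"
  shows "K > 0 \<and> L \<le> K * R"
proof -
  have m: "m > 0"
  proof (rule ccontr)
    assume "\<not> m > 0"
    then show False using L pos by simp
  qed
  have "bounded (\<Union>i\<in>{1..m}. range (x i))" using blk by (intro bounded_UN) auto
  then obtain M where "\<forall>v\<in>(\<Union>i\<in>{1..m}. range (x i)). norm v \<le> M" unfolding bounded_iff by blast
  then have M: "norm (x i k) \<le> M" if "i \<in> {1..m}" for i k using that by blast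
  have blk': "block_basis e (x i)" if "i \<in> {1..m}" for i using blk[OF that] by blast
  obtain \<rho> :: "nat \<Rightarrow> nat \<Rightarrow> nat" and l :: "nat \<Rightarrow> nat" where
    span: "\<And>n. (\<Sum>i\<in>{1..m}. x i (\<rho> i n)) \<in> span (e ` {l n..<l (Suc n)})" and
    l: "strict_mono l" and
    nearL: "\<And>n. \<bar>norm (\<Sum>i\<in>{1..m}. x i (\<rho> i n)) - L\<bar> \<le> 1 / (real n + 1)" and
    nearR: "\<And>g. strict_mono g \<Longrightarrow>
       \<bar>norm (\<Sum>i\<in>{1..m}. x (\<sigma> i) (\<rho> (\<sigma> i) (g i))) - R\<bar> \<le> 1 / (real (g 0) + 1)"
    using ex_fast_block_subsequences[OF m blk' \<sigma> L R] by blast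
  define W where "W n = (\<Sum>i\<in>{1..m}. x i (\<rho> i n))" for n
  obtain n1 :: nat where n1: "1 / (real n1 + 1) < L"
    using nat_approx_posE[OF pos] by (metis of_nat_Suc add.commute)
  have Wnz: "W n \<noteq> 0" if "n1 \<le> n" for n
  proof
    assume "W n = 0"
    then have "L \<le> 1 / (real n + 1)" using nearL[of n] by (simp add: W_def)
    also have "\<dots> \<le> 1 / (real n1 + 1)"
      using that by (intro divide_left_mono) (auto simp: add_pos_nonneg)
    finally show False using n1 by simp
  qed
  define v where "v n = (1 / norm (W (n + n1))) *\<^sub>R W (n + n1)" for n
  have v1: "norm (v n) = 1" for n using Wnz[of "n + n1"] by (simp add: v_def)
  obtain h and y :: "nat \<Rightarrow> linf" where h: "strict_mono h" and y: "spreading_model (v \<circ> h) y"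
    using ex_spreading_model_subsequence[of v] v1 by auto
  define H where "H n = h n + n1" for n
  have H: "strict_mono H" using h by (auto simp: H_def strict_mono_def)
  have Wv: "W (H n) = norm (W (H n)) *\<^sub>R v (h n)" for n
    using Wnz[of "H n"] by (simp add: v_def H_def)
  have "block_basis e (v \<circ> h)"
  proof (rule block_basisI[where l = "l \<circ> H"])
    fix n
    have "l (Suc (H n)) \<le> l (H (Suc n))"
      using strict_monoD[OF H, of n "Suc n"] strict_mono_less_eq[OF l] by simp
    then have "span (e ` {l (H n)..<l (Suc (H n))}) \<subseteq> span (e ` {l (H n)..<l (H (Suc n))})"
      by (intro span_mono image_mono) auto
    then show "(v \<circ> h) n \<in> span (e ` {(l \<circ> H) n..<(l \<circ> H) (Suc n)})"
      using span[of "H n"] by (auto simp: v_def H_def W_def intro!: span_scale)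
    show "(v \<circ> h) n \<noteq> 0" using v1[of "h n"] by auto
  qed
  moreover have "normalized (v \<circ> h)" using v1 by (simp add: normalized_def)
  ultimately have "K_equivalent K y l1_unit" using y by (rule l1)
  moreover have "norm (y 0) = 1"
    using spreading_model_norm_limit[OF y, of 1 "\<lambda>_. 1"] v1 by (simp add: LIMSEQ_const_iff)
  ultimately have K: "K > 0" and lower: "real N \<le> K * norm (\<Sum>i<N. y i)" for N
    by (rule K_equivalent_l1_lower_bound)+
  \<comment> \<open>Replacing \<open>L *\<^sub>R v\<close> by \<open>W\<close>, and the norm of each diagonal by \<open>R\<close>, costs \<open>1 / (t + 1)\<close> per
    term along the \<open>t\<close>-th translate; these errors vanish in the limit that defines the norm of
    \<open>y 0 + \<dots> + y (N - 1)\<close>.\<close>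
  have upper: "L * norm (\<Sum>i<N. y i) \<le> real N * R + 2 * real m * real m * M" for N
  proof -
    have "L * norm (\<Sum>j<N. v (h (t + j))) \<le>
        real N * (R + 1 / (real t + 1)) + 2 * real m * real m * M + real N * (1 / (real t + 1))" for t
    proof -
      have near: "1 / (real s + 1) \<le> 1 / (real t + 1)" if "t \<le> s" for s
        using that by (intro divide_left_mono) (auto simp: add_pos_nonneg)
      have H_ge: "t \<le> H (t + j)" for j
        using strict_mono_imp_increasing[OF H, of "t + j"] by simp
      have "L *\<^sub>R (\<Sum>j<N. v (h (t + j))) =
          (\<Sum>j<N. W (H (t + j))) + (\<Sum>j<N. (L - norm (W (H (t + j)))) *\<^sub>R v (h (t + j)))"
        unfolding scaleR_sum_right sum.distrib[symmetric]
        by (rule sum.cong[OF refl]) (subst Wv, simp add: scaleR_left_diff_distrib v1)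
      then have "norm (L *\<^sub>R (\<Sum>j<N. v (h (t + j)))) \<le> norm (\<Sum>j<N. W (H (t + j))) +
          norm (\<Sum>j<N. (L - norm (W (H (t + j)))) *\<^sub>R v (h (t + j)))"
        using norm_triangle_ineq by metis
      also have "norm (\<Sum>j<N. (L - norm (W (H (t + j)))) *\<^sub>R v (h (t + j))) \<le>
          (\<Sum>j<N. 1 / (real t + 1))"
      proof (rule sum_norm_le)
        fix j
        show "norm ((L - norm (W (H (t + j)))) *\<^sub>R v (h (t + j))) \<le> 1 / (real t + 1)"
          using nearL[of "H (t + j)"] near[OF H_ge, of j]
          by (simp add: v1 W_def abs_minus_commute)
      qed
      also have "norm (\<Sum>j<N. W (H (t + j))) \<le>
          real N * (R + 1 / (real t + 1)) + 2 * real m * real m * M"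
        unfolding W_def
      proof (rule norm_sum_le_diagonals[OF M \<sigma>])
        fix j
        have "strict_mono (\<lambda>i. H (t + (j + i)))" using H by (auto simp: strict_mono_def)
        from nearR[OF this] near[OF H_ge, of j]
        show "norm (\<Sum>i\<in>{1..m}. x (\<sigma> i) (\<rho> (\<sigma> i) (H (t + (j + i))))) \<le> R + 1 / (real t + 1)"
          by simp
      qed
      finally show ?thesis using pos by (simp add: algebra_simps)
    qed
    moreover have "(\<lambda>t. L * norm (\<Sum>j<N. v (h (t + j)))) \<longlonglongrightarrow> L * norm (\<Sum>i<N. y i)"
      using spreading_model_norm_limit[OF y, of N "\<lambda>_. 1"] by (intro tendsto_mult_left) simp
    moreover have "(\<lambda>t. 1 / (real t + 1)) \<longlonglongrightarrow> 0"
      using LIMSEQ_inverse_real_of_nat by (simp add: inverse_eq_divide add.commute)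
    then have "(\<lambda>t. real N * (R + 1 / (real t + 1)) + 2 * real m * real m * M +
        real N * (1 / (real t + 1))) \<longlonglongrightarrow> real N * (R + 0) + 2 * real m * real m * M + real N * 0"
      by (intro tendsto_intros)
    ultimately show ?thesis using LIMSEQ_le by fastforce
  qed
  have "real N * (L - K * R) \<le> K * (2 * real m * real m * M)" for N
  proof -
    have "L * real N \<le> L * (K * norm (\<Sum>i<N. y i))"
      using lower[of N] pos by (intro mult_left_mono) auto
    also have "\<dots> = K * (L * norm (\<Sum>i<N. y i))" by simp
    also have "\<dots> \<le> K * (real N * R + 2 * real m * real m * M)"
      using upper[of N] K by (intro mult_left_mono) auto
    finally show ?thesis by (simp add: algebra_simps)
  qed
  then have "\<not> L - K * R > 0" using reals_Archimedean3 not_le by metis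
  then show ?thesis using K by simp
qed

theorem theorem2p3:
  fixes e :: "nat \<Rightarrow> 'a::banach" and K :: real
  assumes "schauder_basis e"
    and "\<And>(x :: nat \<Rightarrow> 'a) (y :: nat \<Rightarrow> linf).
           block_basis e x \<Longrightarrow> normalized x \<Longrightarrow> spreading_model x y \<Longrightarrow> K_equivalent K y l1_unit"
  shows "block_asymptotically_symmetric e"
  unfolding block_asymptotically_symmetric_def
proof (intro exI[of _ "\<bar>K\<bar>"] allI impI)
  fix m :: nat and x :: "nat \<Rightarrow> nat \<Rightarrow> 'a" and \<sigma> :: "nat \<Rightarrow> nat" and L R :: real
  assume blk: "\<forall>i\<in>{1..m}. block_basis e (x i) \<and> bounded (range (x i))"
    and \<sigma>: "\<sigma> permutes {1..m}"
    and L: "has_iterated_limit [1..<Suc m] (\<lambda>n. norm (\<Sum>i\<in>{1..m}. x i (n i))) L"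
    and R: "has_iterated_limit (map \<sigma> [1..<Suc m]) (\<lambda>n. norm (\<Sum>i\<in>{1..m}. x i (n i))) R"
  show "L \<le> \<bar>K\<bar> * R"
  proof (cases "L > 0")
    case True
    have "K > 0 \<and> L \<le> K * R"
      by (rule iterated_limit_le_permuted[OF assms(2) _ \<sigma> L R True]) (use blk in auto)
    then show ?thesis by simp
  next
    case False
    \<comment> \<open>For \<open>L \<le> 0\<close> no normalised blocks are available; here any nonnegative constant will do,
      which is why the constant is \<open>\<bar>K\<bar>\<close>.\<close>
    have "0 \<le> R" using has_iterated_limit_nonneg[OF R] by simp
    then show ?thesis using False by (simp add: order_trans[of L 0])
  qed
qed

end
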